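(* Let $D\subset\mathbb R^{2,1}$ be a domain of dependence with initial singularity $T\subset\partial D$ and extended singularity $\hat T\subset\partial D$, and let $v$ be a future-directed timelike unit vector. Consider the function $I_v:\partial D\to\mathbb R_{\ge 0}$ defined by $$I_v(q_0)=-\langle q_0-\mathbf r_0(q_0),v\rangle .$$ If $T$ is closed in $\partial D$, then $T=\hat T$, and $\iota_\epsilon$ converges uniformly to $I_v$ as $\epsilon\to0$ (where $I_v$ is regarded as a function on $P_v$ through the identification $x\mapsto x+u_0(x)v\in\partial D$). As a consequence, the function $\iota_v=I_v$ is continuous.
   Context: $\mathbb R^{2,1}$ is $\mathbb R^{3}$ with the Minkowski form $\langle x,x\rangle=-x_0^2+x_1^2+x_2^2$, time-oriented by $x_0$. A domain of dependence is an open convex domain $D$ which is the intersection of the futures of a family of lightlike planes, such that the complement of $D$ contains at least two non-parallel lightlike planes. The cosmological time $\tau:D\to(0,\infty)$ is the supremum of the Lorentzian lengths of causal curves in $D$ ending at the given point; it is finite and $C^{1,1}$. For $p\in D$ there is a unique $\mathbf r(p)\in\partial D\cap I^-(p)$ with $\tau(p)=\sqrt{-\langle p-\mathbf r(p),p-\mathbf r(p)\rangle}$. The initial singularity is $T=\mathbf r(D)\subset\partial D$. The map $\mathbf r_0$: every $q_0\in\partial D$ lies on a lightlike ray contained in $\partial D$ which is maximal with respect to inclusion; such a ray is infinite in the future and has a past endpoint in $\partial D$, which is uniquely determined by $q_0$ and is denoted $\mathbf r_0(q_0)$. The extended singularity is $\hat T=\mathbf r_0(\partial D)$; it contains $T$.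 $P_v$ is the spacelike plane through $0$ orthogonal to $v$. The level surface $H_\epsilon=\tau^{-1}(\epsilon)$ is the graph $\{x+u_\epsilon(x)v: x\in P_v\}$ of a convex function $u_\epsilon$, and $\partial D$ is the graph $\{x+u_0(x)v : x\in P_v\}$ of a convex function $u_0=\lim_{\epsilon\to0}u_\epsilon$. With $\nu_\epsilon$ the future-directed unit normal of $H_\epsilon$, put $\iota_\epsilon(x)=-\epsilon\langle\nu_\epsilon(x+u_\epsilon(x)v),v\rangle$ for $x\in P_v$, and $\iota_v(x)=\lim_{\epsilon\to0}\iota_\epsilon(x)$ (the limit exists, is finite and equals the infimum over $\epsilon>0$).
   Formalization: Uniform convergence of ι_ε to I_v is stated on compact subsets of P_v; on all of P_v it fails for some closed T, e.g. an infinite polygonal line in a timelike plane with edges (1, √(1+4⁻ⁿ), 0). *)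

theory Defs
  imports "HOL-Analysis.Analysis"
begin

section \<open>Minkowski space\<close>

text \<open>The underlying space of R^{2,1} is \<^typ>\<open>real^3\<close>; the coordinates (x_0, x_1, x_2) are
  (x $ 1, x $ 2, x $ 3), so that x $ 1 is the time coordinate.\<close>

type_synonym minkowski = "real^3"

definition minkowski_inner :: "minkowski \<Rightarrow> minkowski \<Rightarrow> real"
  where "minkowski_inner x y = - (x $ 1 * y $ 1) + x $ 2 * y $ 2 + x $ 3 * y $ 3"

definition timelike :: "minkowski \<Rightarrow> bool"
  where "timelike x \<longleftrightarrow> minkowski_inner x x < 0"

definition lightlike :: "minkowski \<Rightarrow> bool"
  where "lightlike x \<longleftrightarrow> x \<noteq> 0 \<and> minkowski_inner x x = 0"

definition causal :: "minkowski \<Rightarrow> bool"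
  where "causal x \<longleftrightarrow> timelike x \<or> lightlike x"

definition future_directed :: "minkowski \<Rightarrow> bool"
  where "future_directed x \<longleftrightarrow> 0 < x $ 1"

definition chronological_future :: "minkowski set \<Rightarrow> minkowski set"
  where "chronological_future S = {x. \<exists>y\<in>S. timelike (x - y) \<and> future_directed (x - y)}"

definition chronological_past :: "minkowski set \<Rightarrow> minkowski set"
  where "chronological_past S = {x. \<exists>y\<in>S. timelike (y - x) \<and> future_directed (y - x)}"

definition orthogonal_plane :: "minkowski \<Rightarrow> minkowski set"
  where "orthogonal_plane v = {x. minkowski_inner x v = 0}"

definition lightlike_plane :: "minkowski set \<Rightarrow> bool"
  where "lightlike_plane P \<longleftrightarrow> (\<exists>n c. lightlike n \<and> P = {x. minkowski_inner x n = c})"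

section \<open>Domains of dependence and cosmological time\<close>

definition domain_of_dependence :: "minkowski set \<Rightarrow> bool"
  where "domain_of_dependence D \<longleftrightarrow>
    D \<noteq> {} \<and> open D \<and> convex D \<and>
    (\<exists>\<F>. (\<forall>P\<in>\<F>. lightlike_plane P) \<and> D = (\<Inter>P\<in>\<F>. chronological_future P)) \<and>
    (\<exists>P Q. lightlike_plane P \<and> lightlike_plane Q \<and> \<not> affine_parallel P Q \<and>
      P \<subseteq> - D \<and> Q \<subseteq> - D)"

text \<open>Causal curves are piecewise C^1 and future-directed, parametrised by [0,1].\<close>

definition causal_curve :: "(real \<Rightarrow> minkowski) \<Rightarrow> bool"
  where "causal_curve \<gamma> \<longleftrightarrow> valid_path \<gamma> \<and>
    (\<exists>S. finite S \<and> (\<forall>t\<in>{0..1} - S. \<gamma> differentiable (at t) \<and>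
      causal (vector_derivative \<gamma> (at t)) \<and> future_directed (vector_derivative \<gamma> (at t))))"

definition lorentzian_length :: "(real \<Rightarrow> minkowski) \<Rightarrow> real"
  where "lorentzian_length \<gamma> = integral {0..1}
    (\<lambda>t. sqrt (- minkowski_inner (vector_derivative \<gamma> (at t)) (vector_derivative \<gamma> (at t))))"

text \<open>The supremum is taken in the reals: on a domain of dependence the cosmological time is finite.\<close>

definition cosmological_time :: "minkowski set \<Rightarrow> minkowski \<Rightarrow> real"
  where "cosmological_time D p =
    Sup {lorentzian_length \<gamma> |\<gamma>. causal_curve \<gamma> \<and> path_image \<gamma> \<subseteq> D \<and> pathfinish \<gamma> = p}"

definition level_surface :: "minkowski set \<Rightarrow> real \<Rightarrow> minkowski set"
  where "level_surface D \<epsilon> = {p \<in> D. cosmological_time D p = \<epsilon>}"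

definition retraction :: "minkowski set \<Rightarrow> minkowski \<Rightarrow> minkowski"
  where "retraction D p = (THE r. r \<in> frontier D \<inter> chronological_past {p} \<and>
    cosmological_time D p = sqrt (- minkowski_inner (p - r) (p - r)))"

definition initial_singularity :: "minkowski set \<Rightarrow> minkowski set"
  where "initial_singularity D = retraction D ` D"

section \<open>The extended singularity\<close>

definition ray :: "minkowski \<Rightarrow> minkowski \<Rightarrow> minkowski set"
  where "ray a w = {a + s *\<^sub>R w |s. 0 \<le> s}"

text \<open>No lightlike ray in the boundary of a domain of dependence points to the past, so it is enough
  to consider the future-directed ones, for which the past endpoint is the origin of the ray.\<close>

definition maximal_boundary_ray :: "minkowski set \<Rightarrow> minkowski \<Rightarrow> minkowski \<Rightarrow> bool"
  where "maximal_boundary_ray D a w \<longleftrightarrow>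
    lightlike w \<and> future_directed w \<and> ray a w \<subseteq> frontier D \<and>
    (\<forall>b z. lightlike z \<and> future_directed z \<and> ray b z \<subseteq> frontier D \<and> ray a w \<subseteq> ray b z
      \<longrightarrow> ray b z = ray a w)"

definition retraction0 :: "minkowski set \<Rightarrow> minkowski \<Rightarrow> minkowski"
  where "retraction0 D q = (THE a. \<exists>w. maximal_boundary_ray D a w \<and> q \<in> ray a w)"

definition extended_singularity :: "minkowski set \<Rightarrow> minkowski set"
  where "extended_singularity D = retraction0 D ` frontier D"

definition I_fun :: "minkowski set \<Rightarrow> minkowski \<Rightarrow> minkowski \<Rightarrow> real"
  where "I_fun D v q = - minkowski_inner (q - retraction0 D q) v"

section \<open>Level surfaces as graphs\<close>

text \<open>The height s for which x + s v lies on the surface S; for S = level_surface D \<open>\<epsilon>\<close> this is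
  the function u_\<open>\<epsilon>\<close>, and for S = frontier D it is u_0.\<close>

definition graph_height :: "minkowski set \<Rightarrow> minkowski \<Rightarrow> minkowski \<Rightarrow> real"
  where "graph_height S v x = (THE s. x + s *\<^sub>R v \<in> S)"

definition graph_point :: "minkowski set \<Rightarrow> minkowski \<Rightarrow> minkowski \<Rightarrow> minkowski"
  where "graph_point S v x = x + graph_height S v x *\<^sub>R v"

definition tangent_vector :: "minkowski set \<Rightarrow> minkowski \<Rightarrow> minkowski \<Rightarrow> bool"
  where "tangent_vector S p w \<longleftrightarrow>
    (\<exists>\<gamma>. \<gamma> 0 = p \<and> (\<forall>\<^sub>F t in nhds (0::real). \<gamma> t \<in> S) \<and> (\<gamma> has_vector_derivative w) (at 0))"

definition future_unit_normal :: "minkowski set \<Rightarrow> minkowski \<Rightarrow> minkowski"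
  where "future_unit_normal S p = (THE n. minkowski_inner n n = -1 \<and> future_directed n \<and>
    (\<forall>w. tangent_vector S p w \<longrightarrow> minkowski_inner n w = 0))"

definition iota_eps :: "minkowski set \<Rightarrow> minkowski \<Rightarrow> real \<Rightarrow> minkowski \<Rightarrow> real"
  where "iota_eps D v \<epsilon> x = - \<epsilon> * minkowski_inner
    (future_unit_normal (level_surface D \<epsilon>) (graph_point (level_surface D \<epsilon>) v x)) v"

definition iota :: "minkowski set \<Rightarrow> minkowski \<Rightarrow> minkowski \<Rightarrow> real"
  where "iota D v x = Lim (at_right 0) (\<lambda>\<epsilon>. iota_eps D v \<epsilon> x)"

text \<open>Uniform convergence of functions on a non-compact plane is meant on compact subsets. For
  \<^const>\<open>iota_eps\<close> it fails on the whole plane even if the initial singularity is closed: take for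
  it an infinite polygonal line in a timelike plane whose n-th edge has time extent 1 and
  Minkowski square 4^{-n}; then for each fixed \<open>\<epsilon>\<close> the values of \<^const>\<open>iota_eps\<close> above the
  vertices are unbounded, whereas \<^const>\<open>I_fun\<close> vanishes at the vertices.\<close>

definition uniform_limit_on_compacts ::
    "'a::topological_space set \<Rightarrow> ('b \<Rightarrow> 'a \<Rightarrow> 'c::metric_space) \<Rightarrow> ('a \<Rightarrow> 'c) \<Rightarrow> 'b filter \<Rightarrow> bool"
  where "uniform_limit_on_compacts S f l F \<longleftrightarrow>
    (\<forall>K. compact K \<and> K \<subseteq> S \<longrightarrow> uniform_limit K f l F)"

end

theory Submission
  imports Defs
begin

text \<open>For \<open>p \<in> D\<close> the point \<open>r(p)\<close> maximises the Lorentzian distance to \<open>p\<close> over the closure of \<open>D\<close>,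
  hence \<open>p - r(p)\<close> is normal to a spacelike support plane of \<open>D\<close> at \<open>r(p)\<close>, the unit normal of the
  level surface at \<open>p\<close> is \<open>(p - r(p)) / \<epsilon>\<close>, and \<open>\<iota>\<^sub>\<epsilon> = -\<langle>p - r(p), v\<rangle>\<close>. A point of the closure in the
  causal past of \<open>q \<in> \<partial>D\<close> lies on the lightlike boundary ray through \<open>q\<close>, and the only point of that
  ray which can have a spacelike support plane is its endpoint \<open>r\<^sub>0(q)\<close>. So if \<open>T\<close> is closed, then by
  compactness points \<open>t \<in> T\<close> in the causal past of \<open>p\<close> converge to \<open>r\<^sub>0(q)\<close> whenever \<open>p\<close> converges to
  \<open>q\<close>. Taking \<open>t = r(p)\<close> with \<open>p\<close> above \<open>q\<close> gives \<open>T = r\<^sub>0(\<partial>D)\<close> and the locally uniform convergence of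
  \<open>\<iota>\<^sub>\<epsilon>\<close>; taking \<open>t = r\<^sub>0(p)\<close> with \<open>p \<in> \<partial>D\<close> gives the continuity of \<open>r\<^sub>0\<close>.\<close>

section \<open>The causal cone\<close>

text \<open>All compactness comes from the two non-parallel lightlike planes. The sum of their
  future null normals is a timelike \<open>m\<close> whose product with the points of
  \<open>D\<close> is bounded above, and this confines the part of the closure in the causal past of
  a bounded set. The future of a single lightlike plane shows the obstacle: causal pasts are
  unbounded there, no maximiser r(p) exists, and boundary rays extend to full lines without a past
  endpoint. Products of future causal vectors are nonpositive, so support inequalities for
  \<open>D\<close> read \<open>x \<bullet>\<^sub>M n \<le> c\<close> with \<open>n\<close> future
  directed. Closedness of T keeps a spacelike support plane at a limit of feet: a mere limit of
  spacelike support planes may be lightlike, and a lightlike one exists along the whole boundary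
  ray.\<close>

abbreviation (input) mink_prod (infix "\<bullet>\<^sub>M" 70)
  where "x \<bullet>\<^sub>M y \<equiv> minkowski_inner x y"

text \<open>Includes 0, unlike the predicate \<open>causal\<close>, so that the cone is closed and
  convex: causal relations pass to limits and add up.\<close>

definition causal_cone :: "minkowski set"
  where "causal_cone = {w. 0 \<le> w $ 1 \<and> w \<bullet>\<^sub>M w \<le> 0}"

definition timelike_cone :: "minkowski set"
  where "timelike_cone = {w. 0 < w $ 1 \<and> w \<bullet>\<^sub>M w < 0}"

definition mink_norm :: "minkowski \<Rightarrow> real"
  where "mink_norm w = sqrt (- (w \<bullet>\<^sub>M w))"

abbreviation time_axis :: minkowski
  where "time_axis \<equiv> axis 1 1"

interpretation minkowski: bounded_bilinear minkowski_inner
proof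
  fix a a' b b' :: minkowski and r :: real
  show "(a + a') \<bullet>\<^sub>M b = a \<bullet>\<^sub>M b + a' \<bullet>\<^sub>M b" "a \<bullet>\<^sub>M (b + b') = a \<bullet>\<^sub>M b + a \<bullet>\<^sub>M b'"
    "(r *\<^sub>R a) \<bullet>\<^sub>M b = r *\<^sub>R (a \<bullet>\<^sub>M b)" "a \<bullet>\<^sub>M (r *\<^sub>R b) = r *\<^sub>R (a \<bullet>\<^sub>M b)"
    by (simp_all add: minkowski_inner_def algebra_simps)
  show "\<exists>K. \<forall>a b. norm (a \<bullet>\<^sub>M b) \<le> norm a * norm b * K"
  proof (intro exI allI)
    fix a b :: minkowski
    have "norm (a \<bullet>\<^sub>M b) \<le> \<bar>a $ 1 * b $ 1\<bar> + \<bar>a $ 2 * b $ 2\<bar> + \<bar>a $ 3 * b $ 3\<bar>"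
      by (simp add: minkowski_inner_def)
    also have "\<dots> \<le> norm a * norm b + norm a * norm b + norm a * norm b"
      unfolding abs_mult by (intro add_mono mult_mono component_le_norm_cart) auto
    finally show "norm (a \<bullet>\<^sub>M b) \<le> norm a * norm b * 3"
      by simp
  qed
qed

lemmas mink_simps = minkowski.add_left minkowski.add_right minkowski.diff_left minkowski.diff_right
  minkowski.scaleR_left minkowski.scaleR_right minkowski.minus_left minkowski.minus_right

lemma mink_commute: "x \<bullet>\<^sub>M y = y \<bullet>\<^sub>M x"
  by (simp add: minkowski_inner_def)

lemma mink_time_axis [simp]: "time_axis \<bullet>\<^sub>M w = - w $ 1" "w \<bullet>\<^sub>M time_axis = - w $ 1"
  by (simp_all add: minkowski_inner_def axis_def)

lemma mink_le_norm_sq: "x \<bullet>\<^sub>M x \<le> (norm x)\<^sup>2"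
  by (simp add: minkowski_inner_def power2_norm_eq_inner inner_vec_def sum_3)

lemma timelike_subset_causal: "timelike_cone \<subseteq> causal_cone"
  by (auto simp: timelike_cone_def causal_cone_def)

lemma zero_in_causal_cone [simp]: "0 \<in> causal_cone"
  by (simp add: causal_cone_def minkowski.zero_left)

lemma time_axis_timelike [simp]: "time_axis \<in> timelike_cone"
  by (simp add: timelike_cone_def)

lemma timelike_future_iff: "timelike x \<and> future_directed x \<longleftrightarrow> x \<in> timelike_cone"
  by (auto simp: timelike_def future_directed_def timelike_cone_def)

lemma mink_nonpos_zero_time:
  assumes "w \<bullet>\<^sub>M w \<le> 0" "w $ 1 = 0"
  shows "w = 0"
proof -
  have "(w $ 2)\<^sup>2 + (w $ 3)\<^sup>2 \<le> 0"
    using assms by (simp add: minkowski_inner_def power2_eq_square)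
  then have "w $ 2 = 0" "w $ 3 = 0"
    by (simp_all add: sum_power2_le_zero_iff)
  with assms show ?thesis
    by (simp add: vec_eq_iff forall_3)
qed

lemma causal_cone_time_pos: "w \<in> causal_cone \<Longrightarrow> w \<noteq> 0 \<Longrightarrow> 0 < w $ 1"
  using mink_nonpos_zero_time[of w] by (force simp: causal_cone_def)

lemma lightlike_future_iff:
  "lightlike w \<and> future_directed w \<longleftrightarrow> w \<in> causal_cone \<and> w \<noteq> 0 \<and> w \<bullet>\<^sub>M w = 0"
  using causal_cone_time_pos[of w]
  by (auto simp: lightlike_def future_directed_def causal_cone_def)

lemma causal_future_iff: "causal w \<and> future_directed w \<longleftrightarrow> w \<in> causal_cone \<and> w \<noteq> 0"
  using causal_cone_time_pos[of w]
  by (auto simp: causal_def timelike_def lightlike_def future_directed_def causal_cone_def)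

lemma open_timelike_cone: "open timelike_cone"
  unfolding timelike_cone_def
  by (intro open_Collect_conj open_Collect_less continuous_intros minkowski.continuous_on)

lemma closed_causal_cone: "closed causal_cone"
  unfolding causal_cone_def
  by (intro closed_Collect_conj closed_Collect_le continuous_intros minkowski.continuous_on)

lemma causal_cone_scaleR: "w \<in> causal_cone \<Longrightarrow> 0 \<le> s \<Longrightarrow> s *\<^sub>R w \<in> causal_cone"
  by (auto simp: causal_cone_def mink_simps intro!: mult_nonneg_nonpos)

lemma timelike_cone_scaleR: "w \<in> timelike_cone \<Longrightarrow> 0 < s \<Longrightarrow> s *\<^sub>R w \<in> timelike_cone"
  by (auto simp: timelike_cone_def mink_simps intro!: mult_pos_neg)

lemma mink_norm_nonneg: "w \<in> causal_cone \<Longrightarrow> 0 \<le> mink_norm w"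
  by (simp add: causal_cone_def mink_norm_def)

lemma mink_norm_pos: "w \<in> timelike_cone \<Longrightarrow> 0 < mink_norm w"
  by (simp add: timelike_cone_def mink_norm_def)

lemma mink_norm_sq: "w \<in> causal_cone \<Longrightarrow> (mink_norm w)\<^sup>2 = - (w \<bullet>\<^sub>M w)"
  by (simp add: causal_cone_def mink_norm_def)

lemma mink_norm_scaleR: "0 \<le> s \<Longrightarrow> mink_norm (s *\<^sub>R w) = s * mink_norm w"
proof -
  assume "0 \<le> s"
  have "mink_norm (s *\<^sub>R w) = sqrt (s\<^sup>2 * - (w \<bullet>\<^sub>M w))"
    unfolding mink_norm_def mink_simps power2_eq_square by simp
  with \<open>0 \<le> s\<close> show ?thesis
    unfolding real_sqrt_mult mink_norm_def by simp
qed

text \<open>The spatial part of a causal vector is bounded by its time component, so this reduces to the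
  Cauchy-Schwarz inequality in the plane.\<close>

lemma reverse_cauchy_schwarz:
  assumes "u \<in> causal_cone" "w \<in> causal_cone"
  shows "mink_norm u * mink_norm w \<le> - (u \<bullet>\<^sub>M w)"
proof -
  define a where "a = sqrt ((u $ 2)\<^sup>2 + (u $ 3)\<^sup>2)"
  define b where "b = sqrt ((w $ 2)\<^sup>2 + (w $ 3)\<^sup>2)"
  have a: "0 \<le> a" "a\<^sup>2 = (u $ 2)\<^sup>2 + (u $ 3)\<^sup>2" and b: "0 \<le> b" "b\<^sup>2 = (w $ 2)\<^sup>2 + (w $ 3)\<^sup>2"
    by (simp_all add: a_def b_def)
  have "a \<le> u $ 1" "b \<le> w $ 1"
    unfolding a_def b_def using assms
    by (auto intro!: real_le_lsqrt simp: causal_cone_def minkowski_inner_def power2_eq_square)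
  have "u $ 2 * w $ 2 + u $ 3 * w $ 3 \<le> a * b"
  proof (rule power2_le_imp_le)
    have "0 \<le> (u $ 2 * w $ 3 - u $ 3 * w $ 2)\<^sup>2"
      by simp
    then show "(u $ 2 * w $ 2 + u $ 3 * w $ 3)\<^sup>2 \<le> (a * b)\<^sup>2"
      unfolding power_mult_distrib a(2) b(2) by (simp add: power2_eq_square algebra_simps)
  qed (use a b in simp)
  then have "u $ 1 * w $ 1 - a * b \<le> - (u \<bullet>\<^sub>M w)"
    by (simp add: minkowski_inner_def)
  moreover have "mink_norm u * mink_norm w \<le> u $ 1 * w $ 1 - a * b"
  proof -
    have "a * b \<le> u $ 1 * w $ 1"
      using \<open>a \<le> u $ 1\<close> \<open>b \<le> w $ 1\<close> a b by (intro mult_mono) auto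
    moreover have "mink_norm u = sqrt ((u $ 1)\<^sup>2 - a\<^sup>2)" "mink_norm w = sqrt ((w $ 1)\<^sup>2 - b\<^sup>2)"
      unfolding mink_norm_def minkowski_inner_def a(2) b(2) by (simp_all add: power2_eq_square)
    moreover have "((u $ 1)\<^sup>2 - a\<^sup>2) * ((w $ 1)\<^sup>2 - b\<^sup>2) \<le> (u $ 1 * w $ 1 - a * b)\<^sup>2"
    proof -
      have "0 \<le> (u $ 1 * b - w $ 1 * a)\<^sup>2"
        by simp
      then show ?thesis
        by (simp add: power2_eq_square algebra_simps)
    qed
    ultimately show ?thesis
      by (simp add: real_le_lsqrt flip: real_sqrt_mult)
  qed
  ultimately show ?thesis
    by linarith
qed

lemma causal_mink_nonpos:
  assumes "u \<in> causal_cone" "w \<in> causal_cone"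
  shows "u \<bullet>\<^sub>M w \<le> 0"
  using reverse_cauchy_schwarz[OF assms] mult_nonneg_nonneg[OF assms[THEN mink_norm_nonneg]]
  by linarith

lemma causal_cone_add:
  assumes "u \<in> causal_cone" "w \<in> causal_cone"
  shows "u + w \<in> causal_cone"
  using assms causal_mink_nonpos[OF assms]
  by (simp add: causal_cone_def mink_simps mink_commute)

lemma mink_norm_superadditive:
  assumes "u \<in> causal_cone" "w \<in> causal_cone"
  shows "mink_norm u + mink_norm w \<le> mink_norm (u + w)"
proof (rule power2_le_imp_le)
  show "(mink_norm u + mink_norm w)\<^sup>2 \<le> (mink_norm (u + w))\<^sup>2"
    using reverse_cauchy_schwarz[OF assms] assms
    by (simp add: mink_norm_sq causal_cone_add power2_sum mink_simps mink_commute)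
  show "0 \<le> mink_norm (u + w)"
    using assms by (intro mink_norm_nonneg causal_cone_add)
qed

text \<open>The form is positive definite on the orthogonal complement of a timelike vector:
  otherwise Cauchy-Schwarz for the spatial parts would give
  \<open>(z $ 1 * u $ 1)\<^sup>2 < (z $ 1 * u $ 1)\<^sup>2\<close>. Source of the uniqueness of feet
  and of unit normals.\<close>

lemma mink_orthogonal_timelike_zero:
  assumes "u \<bullet>\<^sub>M u < 0" "z \<bullet>\<^sub>M u = 0" "z \<bullet>\<^sub>M z \<le> 0"
  shows "z = 0"
proof (rule mink_nonpos_zero_time[OF assms(3)], rule ccontr)
  assume z: "z $ 1 \<noteq> 0"
  have "(z $ 1 * u $ 1)\<^sup>2 = (z $ 2 * u $ 2 + z $ 3 * u $ 3)\<^sup>2"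
    using assms(2) by (intro arg_cong[where f = "\<lambda>x. x\<^sup>2"]) (simp add: minkowski_inner_def)
  also have "\<dots> \<le> ((z $ 2)\<^sup>2 + (z $ 3)\<^sup>2) * ((u $ 2)\<^sup>2 + (u $ 3)\<^sup>2)"
  proof -
    have "0 \<le> (u $ 2 * z $ 3 - u $ 3 * z $ 2)\<^sup>2"
      by simp
    then show ?thesis
      by (simp add: power2_eq_square algebra_simps)
  qed
  also have "\<dots> \<le> (z $ 1)\<^sup>2 * ((u $ 2)\<^sup>2 + (u $ 3)\<^sup>2)"
    using assms(3) by (intro mult_right_mono) (simp_all add: minkowski_inner_def power2_eq_square)
  also have "\<dots> < (z $ 1)\<^sup>2 * (u $ 1)\<^sup>2"
    using assms(1) z
    by (intro mult_strict_left_mono) (simp add: minkowski_inner_def power2_eq_square, simp)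
  finally show False
    by (simp add: power_mult_distrib)
qed

lemma timelike_mink_neg:
  assumes "u \<in> timelike_cone" "w \<in> causal_cone" "w \<noteq> 0"
  shows "u \<bullet>\<^sub>M w < 0"
proof -
  have "u \<bullet>\<^sub>M w \<noteq> 0"
    using assms mink_orthogonal_timelike_zero[of u w]
    by (auto simp: timelike_cone_def causal_cone_def mink_commute)
  moreover have "u \<bullet>\<^sub>M w \<le> 0"
    using assms timelike_subset_causal by (intro causal_mink_nonpos) auto
  ultimately show ?thesis
    by simp
qed

lemma timelike_cone_nonzero: "u \<in> timelike_cone \<Longrightarrow> u \<noteq> 0"
  by (auto simp: timelike_cone_def)

text \<open>Removing from \<open>w\<close> the multiple of \<open>u\<close> with the same time
  component leaves a vector that is null, as all mutual products vanish, and has time component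
  0.\<close>

lemma null_orthogonal_parallel:
  assumes "u \<in> causal_cone" "u \<bullet>\<^sub>M u = 0" "u \<noteq> 0" "w \<in> causal_cone" "w \<bullet>\<^sub>M w = 0" "w \<noteq> 0"
    and "u \<bullet>\<^sub>M w = 0"
  obtains k where "0 < k" "w = k *\<^sub>R u"
proof
  have *: "0 < u $ 1" "0 < w $ 1"
    using assms causal_cone_time_pos by auto
  show "0 < w $ 1 / u $ 1"
    using * by simp
  let ?z = "w - (w $ 1 / u $ 1) *\<^sub>R u"
  have "?z = 0"
    using * assms by (intro mink_nonpos_zero_time) (simp_all add: mink_simps mink_commute)
  then show "w = (w $ 1 / u $ 1) *\<^sub>R u"
    by simp
qed

lemma timelike_cone_if_mink_neg:
  assumes "w \<bullet>\<^sub>M w \<le> 0" "u \<in> timelike_cone" "w \<bullet>\<^sub>M u < 0"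
  shows "w \<in> causal_cone"
proof (rule ccontr)
  assume "w \<notin> causal_cone"
  then have "- w \<in> causal_cone"
    using assms(1) by (auto simp: causal_cone_def mink_simps)
  then have "- w \<bullet>\<^sub>M u \<le> 0"
    using assms(2) timelike_subset_causal by (intro causal_mink_nonpos) auto
  then show False
    using assms(3) by (simp add: mink_simps)
qed

text \<open>Spacelike planes cut the causal cone in bounded pieces. With \<open>b\<close> the length
  of the spatial part of \<open>m\<close>, \<open>- (w \<bullet>\<^sub>M m)\<close> is at least
  \<open>w $ 1 * (m $ 1 - b)\<close>, and \<open>b < m $ 1\<close> because \<open>m\<close> is
  timelike. The 3 bounds the norm by three coordinates, each at most \<open>w $ 1\<close> in
  absolute value.\<close>

lemma causal_norm_bound:
  assumes "m \<in> timelike_cone"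
  obtains C where "0 < C" "\<And>w. w \<in> causal_cone \<Longrightarrow> norm w \<le> C * - (w \<bullet>\<^sub>M m)"
proof -
  define b where "b = sqrt ((m $ 2)\<^sup>2 + (m $ 3)\<^sup>2)"
  have "0 < m $ 1" "m $ 1 * m $ 1 > m $ 2 * m $ 2 + m $ 3 * m $ 3"
    using assms by (auto simp: timelike_cone_def minkowski_inner_def)
  then have b: "b < m $ 1"
    unfolding b_def by (intro real_less_lsqrt) (auto simp: power2_eq_square)
  have "norm w \<le> 3 / (m $ 1 - b) * - (w \<bullet>\<^sub>M m)" if w: "w \<in> causal_cone" for w
  proof -
    have le: "0 \<le> w $ 1" "(w $ 2)\<^sup>2 + (w $ 3)\<^sup>2 \<le> (w $ 1)\<^sup>2"
      using w by (auto simp: causal_cone_def minkowski_inner_def power2_eq_square)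
    have "(w $ 2)\<^sup>2 \<le> (w $ 1)\<^sup>2" "(w $ 3)\<^sup>2 \<le> (w $ 1)\<^sup>2"
      using le(2) zero_le_power2[of "w $ 2"] zero_le_power2[of "w $ 3"] by linarith+
    then have "\<bar>w $ 2\<bar> \<le> w $ 1" "\<bar>w $ 3\<bar> \<le> w $ 1"
      using le(1) by (metis abs_le_square_iff abs_of_nonneg)+
    then have "norm w \<le> 3 * w $ 1"
      using norm_le_l1_cart[of w] le(1) by (simp add: sum_3)
    moreover have "w $ 1 * (m $ 1 - b) \<le> - (w \<bullet>\<^sub>M m)"
    proof -
      have "w $ 2 * m $ 2 + w $ 3 * m $ 3 \<le> w $ 1 * b"
      proof (rule power2_le_imp_le)
        have "0 \<le> (w $ 2 * m $ 3 - w $ 3 * m $ 2)\<^sup>2"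
          by simp
        then have "(w $ 2 * m $ 2 + w $ 3 * m $ 3)\<^sup>2 \<le> ((w $ 2)\<^sup>2 + (w $ 3)\<^sup>2) * b\<^sup>2"
          by (simp add: b_def power2_eq_square algebra_simps)
        also have "\<dots> \<le> (w $ 1)\<^sup>2 * b\<^sup>2"
          using le by (intro mult_right_mono) auto
        finally show "(w $ 2 * m $ 2 + w $ 3 * m $ 3)\<^sup>2 \<le> (w $ 1 * b)\<^sup>2"
          by (simp add: power_mult_distrib)
      qed (use le in \<open>simp add: b_def\<close>)
      then show ?thesis
        by (simp add: minkowski_inner_def algebra_simps)
    qed
    then have "w $ 1 \<le> - (w \<bullet>\<^sub>M m) / (m $ 1 - b)"
      using b by (subst pos_le_divide_eq) auto
    ultimately show ?thesis
      by simp
  qed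
  with b show ?thesis
    by (intro that[of "3 / (m $ 1 - b)"]) auto
qed

section \<open>Lengths of causal curves\<close>

text \<open>Integrates the reverse Cauchy-Schwarz inequality between the velocity and the fixed
  \<open>u\<close>. With \<open>u\<close> the vector from a foot to the end of the curve it bounds
  all lengths at once.\<close>

lemma causal_curve_length_bound:
  assumes \<gamma>: "causal_curve \<gamma>" and u: "u \<in> timelike_cone"
  shows "lorentzian_length \<gamma> * mink_norm u \<le> - ((pathfinish \<gamma> - pathstart \<gamma>) \<bullet>\<^sub>M u)"
proof -
  define \<gamma>' where "\<gamma>' = (\<lambda>t. vector_derivative \<gamma> (at t))"
  from \<gamma> obtain S where "finite S" and S: "\<And>t. t \<in> {0..1} - S \<Longrightarrow> \<gamma> differentiable (at t)"
    "\<And>t. t \<in> {0..1} - S \<Longrightarrow> \<gamma>' t \<in> causal_cone"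
    unfolding causal_curve_def \<gamma>'_def using causal_future_iff by blast
  have cont: "continuous_on {0..1} \<gamma>"
    using \<gamma> unfolding causal_curve_def valid_path_def piecewise_C1_differentiable_on_def by blast
  have "((\<lambda>t. \<gamma>' t \<bullet>\<^sub>M u) has_integral (\<gamma> 1 \<bullet>\<^sub>M u - \<gamma> 0 \<bullet>\<^sub>M u)) {0..1}"
  proof (rule fundamental_theorem_of_calculus_interior_strong[OF \<open>finite S\<close>])
    show "((\<lambda>t. \<gamma> t \<bullet>\<^sub>M u) has_vector_derivative \<gamma>' t \<bullet>\<^sub>M u) (at t)" if "t \<in> {0<..<1} - S" for t
      using S(1)[of t] that unfolding \<gamma>'_def vector_derivative_works
      by (intro bounded_linear.has_vector_derivative[OF minkowski.bounded_linear_left]) auto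
    show "continuous_on {0..1} (\<lambda>t. \<gamma> t \<bullet>\<^sub>M u)"
      by (intro minkowski.continuous_on cont continuous_on_const)
  qed simp
  then have "((\<lambda>t. - (\<gamma>' t \<bullet>\<^sub>M u)) has_integral - ((\<gamma> 1 - \<gamma> 0) \<bullet>\<^sub>M u)) {0..1}"
    by (auto dest: has_integral_neg simp: mink_simps)
  \<comment> \<open>The vector derivative is an arbitrary value on the finite set \<open>S\<close>;
    there \<open>g\<close> is set to a nonnegative majorant, so that the comparisons below hold at
    every \<open>t\<close>.\<close>
  moreover define g where
    "g = (\<lambda>t. if t \<in> S then \<bar>mink_norm (\<gamma>' t) * mink_norm u\<bar> else - (\<gamma>' t \<bullet>\<^sub>M u))"
  ultimately have g: "(g has_integral - ((\<gamma> 1 - \<gamma> 0) \<bullet>\<^sub>M u)) {0..1}"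
    by (elim has_integral_spike_finite[OF \<open>finite S\<close>, rotated]) auto
  have u': "u \<in> causal_cone"
    using u timelike_subset_causal by blast
  have le_g: "mink_norm (\<gamma>' t) * mink_norm u \<le> g t" if "t \<in> {0..1}" for t
    using reverse_cauchy_schwarz[OF S(2) u'] that by (auto simp: g_def)
  have g_nonneg: "0 \<le> g t" if "t \<in> {0..1}" for t
    using causal_mink_nonpos[OF S(2) u'] that by (auto simp: g_def)
  have length: "lorentzian_length \<gamma> = integral {0..1} (\<lambda>t. mink_norm (\<gamma>' t))"
    by (simp add: lorentzian_length_def \<gamma>'_def mink_norm_def)
  show ?thesis
  proof (cases "(\<lambda>t. mink_norm (\<gamma>' t)) integrable_on {0..1}")
    case True
    then have "((\<lambda>t. mink_norm (\<gamma>' t) * mink_norm u) has_integral lorentzian_length \<gamma> * mink_norm u) {0..1}"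
      unfolding length by (intro has_integral_mult_left integrable_integral)
    from has_integral_le[OF this g le_g] show ?thesis
      by (simp add: pathfinish_def pathstart_def)
  next
    \<comment> \<open>A non-integrable function has integral 0 by convention, so only the right-hand
      side has to be shown nonnegative.\<close>
    case False
    then have "lorentzian_length \<gamma> = 0"
      unfolding length by (rule not_integrable_integral)
    with has_integral_nonneg[OF g g_nonneg] show ?thesis
      by (simp add: pathfinish_def pathstart_def)
  qed
qed

lemma causal_curve_linepath:
  assumes "b - a \<in> causal_cone" "a \<noteq> b"
  shows "causal_curve (linepath a b)"
  unfolding causal_curve_def
proof (intro conjI exI[of _ "{}"] ballI)
  have *: "causal (b - a) \<and> future_directed (b - a)"
    using assms by (simp add: causal_future_iff)
  fix t :: real
  show "linepath a b differentiable (at t)"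
    using has_vector_derivative_linepath_within by (rule differentiableI_vector)
  show "causal (vector_derivative (linepath a b) (at t))"
    "future_directed (vector_derivative (linepath a b) (at t))"
    using * by simp_all
qed auto

lemma lorentzian_length_linepath: "lorentzian_length (linepath a b) = mink_norm (b - a)"
  by (simp add: lorentzian_length_def mink_norm_def)

section \<open>Future complete convex domains\<close>

lemma closure_mink_le:
  assumes "\<And>x. x \<in> D \<Longrightarrow> x \<bullet>\<^sub>M n \<le> c" "x \<in> closure D"
  shows "x \<bullet>\<^sub>M n \<le> c"
proof -
  have "closed {x. x \<bullet>\<^sub>M n \<le> c}"
    by (intro closed_Collect_le minkowski.continuous_on continuous_intros)
  then have "closure D \<subseteq> {x. x \<bullet>\<^sub>M n \<le> c}"
    using assms(1) by (intro closure_minimal) auto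
  with assms(2) show ?thesis
    by blast
qed

lemma eventually_line_in_open:
  fixes x w :: "'a::real_normed_vector"
  assumes "open S" "x \<in> S"
  shows "\<forall>\<^sub>F t in at_right 0. x + t *\<^sub>R w \<in> S"
proof -
  have "((\<lambda>t. x + t *\<^sub>R w) \<longlongrightarrow> x + 0 *\<^sub>R w) (at_right 0)"
    by (intro tendsto_intros)
  then show ?thesis
    using assms by (auto dest!: topological_tendstoD)
qed

lemma eventually_at_right_0_obtain:
  assumes "\<forall>\<^sub>F t in at_right (0::real). P t"
  obtains t where "0 < t" "P t"
  using eventually_happens[OF eventually_conj[OF assms eventually_at_right_less[of 0]]] by auto

text \<open>Collects what the convex-geometric arguments use. \<open>null_support\<close> stands for
  the family of lightlike planes and gives a lightlike support direction at every boundary point;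
  \<open>timelike_bound\<close> stands for the two non-parallel planes and places \<open>D\<close>
  on one side of a spacelike plane.\<close>

locale future_convex_domain =
  fixes D :: "minkowski set"
  assumes nonempty: "D \<noteq> {}"
    and open_D: "open D"
    and convex_D: "convex D"
    and future_closed: "x \<in> D \<Longrightarrow> w \<in> causal_cone \<Longrightarrow> x + w \<in> D"
    and null_support: "q \<in> frontier D \<Longrightarrow>
      \<exists>n. n \<in> causal_cone \<and> n \<noteq> 0 \<and> n \<bullet>\<^sub>M n = 0 \<and> (\<forall>x\<in>D. x \<bullet>\<^sub>M n < q \<bullet>\<^sub>M n)"
    and timelike_bound: "\<exists>m\<in>timelike_cone. \<exists>c. \<forall>x\<in>D. x \<bullet>\<^sub>M m \<le> c"
begin

lemma in_frontier_iff: "q \<in> frontier D \<longleftrightarrow> q \<in> closure D \<and> q \<notin> D"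
  using open_D by (simp add: frontier_def interior_open)

text \<open>For \<open>f k\<close> in \<open>D\<close> near \<open>x\<close>, the vector
  \<open>x + w - f k\<close> is near \<open>w\<close> and still timelike, since the timelike cone is
  open. It follows that no two boundary points are timelike related.\<close>

lemma closure_timelike_future:
  assumes "x \<in> closure D" "w \<in> timelike_cone"
  shows "x + w \<in> D"
proof -
  obtain f where f: "\<And>k. f k \<in> D" "f \<longlonglongrightarrow> x"
    using assms(1) closure_sequential by metis
  then have "(\<lambda>k. x + w - f k) \<longlonglongrightarrow> x + w - x"
    by (intro tendsto_intros)
  then have "(\<lambda>k. x + w - f k) \<longlonglongrightarrow> w"
    by simp
  from topological_tendstoD[OF this open_timelike_cone assms(2)]
  have "\<forall>\<^sub>F k in sequentially. x + w - f k \<in> timelike_cone" .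
  then obtain k where "x + w - f k \<in> timelike_cone"
    by (auto dest: eventually_happens)
  then have "f k + (x + w - f k) \<in> D"
    using f timelike_subset_causal by (intro future_closed) auto
  then show ?thesis
    by simp
qed

lemma closure_causal_future:
  assumes "x \<in> closure D" "w \<in> causal_cone"
  shows "x + w \<in> closure D"
proof -
  obtain f where f: "\<And>k. f k \<in> D" "f \<longlonglongrightarrow> x"
    using assms(1) closure_sequential by metis
  then have "(\<lambda>k. f k + w) \<longlonglongrightarrow> x + w"
    by (intro tendsto_intros)
  moreover have "f k + w \<in> D" for k
    using f assms(2) by (intro future_closed)
  ultimately show ?thesis
    unfolding closure_sequential by (intro exI[of _ "\<lambda>k. f k + w"]) auto
qed

text \<open>\<open>- ((p - r) \<bullet>\<^sub>M m)\<close> equals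
  \<open>r \<bullet>\<^sub>M m - p \<bullet>\<^sub>M m\<close>, where the first term is at most
  \<open>c\<close> and the second is bounded on \<open>P\<close>; by
  \<open>causal_norm_bound\<close> this controls \<open>norm (p - r)\<close>.\<close>

lemma causal_past_bounded:
  assumes "bounded P"
  shows "bounded {r \<in> closure D. \<exists>p\<in>P. p - r \<in> causal_cone}"
proof -
  obtain m c where m: "m \<in> timelike_cone" and c: "\<And>x. x \<in> D \<Longrightarrow> x \<bullet>\<^sub>M m \<le> c"
    using timelike_bound by blast
  obtain C where C: "0 < C" "\<And>w. w \<in> causal_cone \<Longrightarrow> norm w \<le> C * - (w \<bullet>\<^sub>M m)"
    using causal_norm_bound[OF m] by blast
  obtain K where K: "\<And>a b. norm (a \<bullet>\<^sub>M b) \<le> norm a * norm b * K" "0 < K"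
    using minkowski.pos_bounded by blast
  obtain B where B: "\<And>p. p \<in> P \<Longrightarrow> norm p \<le> B"
    using assms bounded_iff by blast
  have "norm r \<le> B + C * (c + B * norm m * K)"
    if r: "r \<in> closure D" and p: "p \<in> P" "p - r \<in> causal_cone" for r p
  proof -
    have "- (p \<bullet>\<^sub>M m) \<le> norm p * norm m * K"
      using K(1)[of p m] by simp
    also have "\<dots> \<le> B * norm m * K"
      using B[OF p(1)] K(2) by (intro mult_right_mono) auto
    finally have "- ((p - r) \<bullet>\<^sub>M m) \<le> c + B * norm m * K"
      using closure_mink_le[OF c r] by (simp add: mink_simps)
    then have "C * - ((p - r) \<bullet>\<^sub>M m) \<le> C * (c + B * norm m * K)"
      using C(1) by (intro mult_left_mono) auto
    with C(2)[OF p(2)] have "norm (p - r) \<le> C * (c + B * norm m * K)"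
      by linarith
    moreover have "norm r \<le> norm p + norm (p - r)"
      by (metis norm_minus_commute norm_triangle_sub)
    ultimately show ?thesis
      using B[OF p(1)] by linarith
  qed
  then show ?thesis
    unfolding bounded_iff by blast
qed

subsection \<open>Feet\<close>

text \<open>The retraction point, encoded by the first order condition instead of by maximality: the
  spacelike plane through \<open>r\<close> orthogonal to \<open>p - r\<close> supports
  \<open>closure D\<close>. Being affine in \<open>q\<close>, the condition combines directly with
  the reverse Cauchy-Schwarz inequality.\<close>

definition is_foot :: "minkowski \<Rightarrow> minkowski \<Rightarrow> bool"
  where "is_foot p r \<longleftrightarrow> r \<in> closure D \<and> p - r \<in> timelike_cone \<and>
    (\<forall>q\<in>closure D. (q - r) \<bullet>\<^sub>M (p - r) \<le> 0)"

lemma is_footD: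
  assumes "is_foot p r"
  shows "r \<in> closure D" "p - r \<in> timelike_cone" "p - r \<in> causal_cone"
    "q \<in> closure D \<Longrightarrow> (q - r) \<bullet>\<^sub>M (p - r) \<le> 0"
  using assms timelike_subset_causal by (auto simp: is_foot_def)

lemma is_foot_in_domain: "is_foot p r \<Longrightarrow> p \<in> D"
  using closure_timelike_future[of r "p - r"] is_footD by auto

text \<open>A foot is a point of the closure which maximises the Lorentzian distance to \<open>p\<close>; the support
  property is the first order condition at the maximum.\<close>

lemma foot_exists:
  assumes p: "p \<in> D"
  obtains r where "is_foot p r"
proof -
  define K where "K = closure D \<inter> {r. p - r \<in> causal_cone}"
  have "closed {r. p - r \<in> causal_cone}"
    using continuous_closed_vimage[OF closed_causal_cone, of "\<lambda>r. p - r"]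
    by (simp add: vimage_def)
  moreover have "bounded K"
    using causal_past_bounded[of "{p}"] by (auto simp: K_def elim: bounded_subset)
  ultimately have "compact K"
    unfolding compact_eq_bounded_closed K_def by auto
  moreover have "p \<in> K"
    using p closure_subset by (auto simp: K_def)
  moreover have "continuous_on K (\<lambda>q. - ((p - q) \<bullet>\<^sub>M (p - q)))"
    by (intro continuous_intros minkowski.continuous_on)
  ultimately obtain r where r: "r \<in> K"
    and max: "\<And>q. q \<in> K \<Longrightarrow> - ((p - q) \<bullet>\<^sub>M (p - q)) \<le> - ((p - r) \<bullet>\<^sub>M (p - r))"
    using continuous_attains_sup[of K] by blast
  \<comment> \<open>A point of \<open>K\<close> slightly below \<open>p\<close> shows that the
    maximum is positive, so \<open>p - r\<close> is timelike and not just causal.\<close>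
  obtain t where t: "0 < t" "p + t *\<^sub>R (- time_axis) \<in> D"
    using eventually_line_in_open[OF open_D p] by (rule eventually_at_right_0_obtain)
  have "p - t *\<^sub>R time_axis \<in> K"
    using t closure_subset timelike_subset_causal timelike_cone_scaleR[OF time_axis_timelike]
    by (auto simp: K_def)
  from max[OF this] have "t * t \<le> - ((p - r) \<bullet>\<^sub>M (p - r))"
    by (simp add: mink_simps)
  with mult_pos_pos[OF t(1) t(1)] have "(p - r) \<bullet>\<^sub>M (p - r) < 0"
    by linarith
  then have u: "p - r \<in> timelike_cone"
    using r causal_cone_time_pos[of "p - r"]
    by (cases "p = r") (auto simp: K_def timelike_cone_def minkowski.zero_left)
  have "(q - r) \<bullet>\<^sub>M (p - r) \<le> 0" if q: "q \<in> closure D" for q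
  proof -
    have "\<forall>\<^sub>F t in at_right 0. p - r + t *\<^sub>R (r - q) \<in> timelike_cone \<and> t < 1 \<and> 0 < t"
      using eventually_line_in_open[OF open_timelike_cone u, of "r - q"]
        eventually_at_right_real[of 0 "1::real"]
      by (auto elim: eventually_elim2)
    \<comment> \<open>Maximality of \<open>r\<close> against the point a fraction \<open>t\<close>
      of the way to \<open>q\<close>, expanded and divided by \<open>t\<close>; then
      \<open>t\<close> tends to 0.\<close>
    moreover have "2 * ((q - r) \<bullet>\<^sub>M (p - r)) \<le> t * ((q - r) \<bullet>\<^sub>M (q - r))"
      if "p - r + t *\<^sub>R (r - q) \<in> timelike_cone \<and> t < 1 \<and> 0 < t" for t
    proof -
      have t: "p - r + t *\<^sub>R (r - q) \<in> timelike_cone" "t < 1" "0 < t"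
        using that by auto
      have "(1 - t) *\<^sub>R r + t *\<^sub>R q \<in> closure D"
        using convex_closure[OF convex_D] r q t unfolding convex_alt by (auto simp: K_def)
      moreover have eq: "p - r + t *\<^sub>R (r - q) = p - ((1 - t) *\<^sub>R r + t *\<^sub>R q)"
        by (simp add: algebra_simps)
      ultimately have "(1 - t) *\<^sub>R r + t *\<^sub>R q \<in> K"
        using t(1) timelike_subset_causal unfolding eq by (auto simp: K_def)
      from max[OF this] have "t * (2 * ((q - r) \<bullet>\<^sub>M (p - r))) \<le> t * (t * ((q - r) \<bullet>\<^sub>M (q - r)))"
        unfolding eq[symmetric] by (simp add: mink_simps mink_commute algebra_simps)
      then show ?thesis
        using t(3) by simp
    qed
    ultimately have "\<forall>\<^sub>F t in at_right 0. 2 * ((q - r) \<bullet>\<^sub>M (p - r)) \<le> t * ((q - r) \<bullet>\<^sub>M (q - r))"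
      by (rule eventually_mono)
    moreover have "((\<lambda>t. t * ((q - r) \<bullet>\<^sub>M (q - r))) \<longlongrightarrow> 0 * ((q - r) \<bullet>\<^sub>M (q - r))) (at_right 0)"
      by (intro tendsto_intros)
    ultimately have "2 * ((q - r) \<bullet>\<^sub>M (p - r)) \<le> 0 * ((q - r) \<bullet>\<^sub>M (q - r))"
      by (intro tendsto_lowerbound[where F = "at_right (0::real)"]) auto
    then show ?thesis
      by simp
  qed
  with r u have "is_foot p r"
    by (auto simp: is_foot_def K_def)
  then show ?thesis
    by (rule that)
qed

text \<open>From a point of \<open>D\<close> one could move a little further away from
  \<open>p\<close>, along \<open>r - p\<close>, and so cross the support plane.\<close>

lemma foot_frontier:
  assumes "is_foot p r"
  shows "r \<in> frontier D"
proof -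
  have "r \<notin> D"
  proof
    assume "r \<in> D"
    then obtain t where "0 < t" "r + t *\<^sub>R (r - p) \<in> D"
      using eventually_line_in_open[OF open_D] eventually_at_right_0_obtain by metis
    then have "(r + t *\<^sub>R (r - p) - r) \<bullet>\<^sub>M (p - r) \<le> 0"
      using closure_subset by (intro is_footD[OF assms]) auto
    moreover have "r + t *\<^sub>R (r - p) - r = - t *\<^sub>R (p - r)"
      by (simp add: algebra_simps)
    ultimately have "- t * ((p - r) \<bullet>\<^sub>M (p - r)) \<le> 0"
      by (simp only: minkowski.scaleR_left real_scaleR_def)
    with \<open>0 < t\<close> show False
      using is_footD(2)[OF assms] mult_pos_neg[of t "(p - r) \<bullet>\<^sub>M (p - r)"]
      by (auto simp: timelike_cone_def)
  qed
  with is_footD[OF assms] show ?thesis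
    by (simp add: in_frontier_iff)
qed

lemma foot_maximal:
  assumes "is_foot p r" "q \<in> closure D" "p - q \<in> causal_cone"
  shows "mink_norm (p - q) \<le> mink_norm (p - r)"
proof -
  note f = is_footD[OF assms(1)]
  have "mink_norm (p - q) * mink_norm (p - r) \<le> - ((p - q) \<bullet>\<^sub>M (p - r))"
    using assms(3) f(3) by (rule reverse_cauchy_schwarz)
  also have "\<dots> \<le> (mink_norm (p - r))\<^sup>2"
    using f(4)[OF assms(2)] f(3) by (simp add: mink_norm_sq mink_simps)
  finally show ?thesis
    using mink_norm_pos[OF f(2)] by (simp add: power2_eq_square)
qed

text \<open>Equality forces \<open>q - r\<close> to be orthogonal to the timelike
  \<open>p - r\<close>, and equal lengths give \<open>(q - r) \<bullet>\<^sub>M (q - r) = 2 * ((q -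
  r) \<bullet>\<^sub>M (p - r))\<close>, which is then 0.\<close>

lemma foot_unique:
  assumes "is_foot p r" "q \<in> closure D" "p - q \<in> causal_cone"
    and "mink_norm (p - q) = mink_norm (p - r)"
  shows "q = r"
proof -
  note f = is_footD[OF assms(1)]
  have "(mink_norm (p - r))\<^sup>2 \<le> - ((p - q) \<bullet>\<^sub>M (p - r))"
    using reverse_cauchy_schwarz[OF assms(3) f(3)] assms(4) by (simp add: power2_eq_square)
  with f(4)[OF assms(2)] mink_norm_sq[OF f(3)]
  have "(q - r) \<bullet>\<^sub>M (p - r) = 0"
    by (simp add: mink_simps)
  moreover have "(p - q) \<bullet>\<^sub>M (p - q) = (p - r) \<bullet>\<^sub>M (p - r)"
    using mink_norm_sq[OF f(3)] mink_norm_sq[OF assms(3)] assms(4) by simp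
  then have "(q - r) \<bullet>\<^sub>M (q - r) = 2 * ((q - r) \<bullet>\<^sub>M (p - r))"
    by (simp add: mink_simps mink_commute)
  ultimately have "q - r = 0"
    using f(2) by (intro mink_orthogonal_timelike_zero[of "p - r"]) (auto simp: timelike_cone_def)
  then show ?thesis
    by simp
qed

text \<open>No curve in \<open>D\<close> ending at \<open>p\<close> is longer than \<open>M\<close>,
  by the length bound for \<open>u = p - r\<close> and the support condition at the starting point.
  The segment from \<open>r\<close> is not admissible, because \<open>r\<close> lies outside
  \<open>D\<close>; its final parts have length \<open>(1 - t) * M\<close>, so \<open>M\<close> is
  the supremum.\<close>

lemma time_foot:
  assumes "is_foot p r"
  shows "cosmological_time D p = mink_norm (p - r)"
proof -
  note f = is_footD[OF assms]
  define M where "M = mink_norm (p - r)"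
  have "0 < M"
    using f mink_norm_pos by (simp add: M_def)
  define L where
    "L = {lorentzian_length \<gamma> |\<gamma>. causal_curve \<gamma> \<and> path_image \<gamma> \<subseteq> D \<and> pathfinish \<gamma> = p}"
  have upper: "l \<le> M" if l: "l \<in> L" for l
  proof -
    obtain \<gamma> where \<gamma>: "l = lorentzian_length \<gamma>" "causal_curve \<gamma>" "path_image \<gamma> \<subseteq> D" "pathfinish \<gamma> = p"
      using l unfolding L_def by blast
    have "pathstart \<gamma> \<in> closure D"
      using \<gamma>(3) pathstart_in_path_image closure_subset by blast
    then have "l * M \<le> M\<^sup>2"
      using causal_curve_length_bound[OF \<gamma>(2) f(2)] f(4)[of "pathstart \<gamma>"] mink_norm_sq[OF f(3)]
      by (simp add: \<gamma>(1,4) M_def mink_simps)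
    with \<open>0 < M\<close> show ?thesis
      by (simp add: power2_eq_square)
  qed
  have segment: "(1 - t) * M \<in> L" if t: "0 < t" "t < 1" for t
  proof -
    define q where "q = r + t *\<^sub>R (p - r)"
    have pq: "p - q = (1 - t) *\<^sub>R (p - r)"
      by (simp add: q_def algebra_simps)
    have "q \<in> D"
      unfolding q_def using t f by (intro closure_timelike_future timelike_cone_scaleR) auto
    moreover have "p - q \<in> timelike_cone"
      unfolding pq using t f by (intro timelike_cone_scaleR) auto
    moreover have "mink_norm (p - q) = (1 - t) * M"
      unfolding pq M_def using t by (intro mink_norm_scaleR) auto
    moreover have "closed_segment q p \<subseteq> D"
      using \<open>q \<in> D\<close> is_foot_in_domain[OF assms] convex_D by (simp add: closed_segment_subset)
    moreover have "causal_curve (linepath q p)"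
      using \<open>p - q \<in> timelike_cone\<close> timelike_subset_causal timelike_cone_nonzero[of "p - q"]
      by (intro causal_curve_linepath) auto
    ultimately show ?thesis
      unfolding L_def by (auto intro!: exI[of _ "linepath q p"] simp: lorentzian_length_linepath)
  qed
  have "Sup L = M"
  proof (rule cSup_eq)
    show "M \<le> y" if y: "\<And>l. l \<in> L \<Longrightarrow> l \<le> y" for y
    proof -
      have "\<forall>\<^sub>F t in at_right 0. (1 - t) * M \<le> y"
        using eventually_at_right_real[of 0 "1::real"] segment y by (auto elim: eventually_mono)
      moreover have "((\<lambda>t. (1 - t) * M) \<longlongrightarrow> (1 - 0) * M) (at_right 0)"
        by (intro tendsto_intros)
      ultimately have "(1 - 0) * M \<le> y"
        by (intro tendsto_upperbound[where F = "at_right (0::real)"]) auto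
      then show ?thesis
        by simp
    qed
  qed (use upper in auto)
  then show ?thesis
    by (simp add: cosmological_time_def L_def M_def)
qed

lemma retraction_foot:
  assumes "is_foot p r"
  shows "retraction D p = r"
  unfolding retraction_def
proof (rule the_equality)
  note f = is_footD[OF assms]
  show "r \<in> frontier D \<inter> chronological_past {p} \<and>
      cosmological_time D p = sqrt (- minkowski_inner (p - r) (p - r))"
    using foot_frontier[OF assms] f(2) time_foot[OF assms]
    by (auto simp: chronological_past_def timelike_future_iff mink_norm_def)
  fix q
  assume q: "q \<in> frontier D \<inter> chronological_past {p} \<and>
      cosmological_time D p = sqrt (- minkowski_inner (p - q) (p - q))"
  show "q = r"
  proof (rule foot_unique[OF assms])
    show "q \<in> closure D" "p - q \<in> causal_cone"
      using q timelike_subset_causal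
      by (auto simp: in_frontier_iff chronological_past_def timelike_future_iff)
    show "mink_norm (p - q) = mink_norm (p - r)"
      using q time_foot[OF assms] by (simp add: mink_norm_def)
  qed
qed

lemma is_foot_retraction: "p \<in> D \<Longrightarrow> is_foot p (retraction D p)"
  using foot_exists retraction_foot by metis

section \<open>Cosmological time as a distance: superlevel sets, growth, continuity\<close>

lemma time_retraction: "p \<in> D \<Longrightarrow> cosmological_time D p = mink_norm (p - retraction D p)"
  using is_foot_retraction time_foot by blast

lemma time_pos: "p \<in> D \<Longrightarrow> 0 < cosmological_time D p"
  using time_retraction is_footD(2)[OF is_foot_retraction] mink_norm_pos by simp

lemma time_lower_bound:
  assumes "p \<in> D" "q \<in> closure D" "p - q \<in> causal_cone"
  shows "mink_norm (p - q) \<le> cosmological_time D p"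
  using foot_maximal[OF is_foot_retraction] assms by (simp add: time_retraction)

text \<open>Split \<open>q - p\<close> as \<open>(q - s) + (s - r) + (r - p)\<close>, with
  \<open>r\<close> and \<open>s\<close> the feet of \<open>p\<close> and \<open>q\<close>: the first
  summand is estimated by reverse Cauchy-Schwarz, the second by the support plane at
  \<open>r\<close>.\<close>

lemma superlevel_support:
  assumes "p \<in> D" "q \<in> D" "cosmological_time D p \<le> cosmological_time D q"
  shows "(q - p) \<bullet>\<^sub>M (p - retraction D p) \<le> 0"
proof -
  define r where "r = retraction D p"
  define s where "s = retraction D q"
  have r: "is_foot p r" and s: "is_foot q s"
    using assms is_foot_retraction by (auto simp: r_def s_def)
  note r = is_footD[OF r] and s = is_footD[OF s]
  have "mink_norm (p - r) \<le> mink_norm (q - s)"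
    using assms by (simp add: time_retraction r_def s_def)
  then have "(mink_norm (p - r))\<^sup>2 \<le> mink_norm (q - s) * mink_norm (p - r)"
    using mink_norm_nonneg[OF r(3)] by (simp add: power2_eq_square mult_right_mono)
  also have "\<dots> \<le> - ((q - s) \<bullet>\<^sub>M (p - r))"
    using s(3) r(3) by (rule reverse_cauchy_schwarz)
  finally show ?thesis
    using r(4)[OF s(1)] mink_norm_sq[OF r(3)] by (simp add: r_def[symmetric] mink_simps)
qed

lemma time_increasing:
  assumes "p \<in> D" "w \<in> causal_cone"
  shows "cosmological_time D p + mink_norm w \<le> cosmological_time D (p + w)"
proof -
  define r where "r = retraction D p"
  have r: "is_foot p r"
    using assms is_foot_retraction by (auto simp: r_def)
  note f = is_footD[OF r]
  have eq: "p + w - r = (p - r) + w"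
    by simp
  have "cosmological_time D p + mink_norm w \<le> mink_norm (p + w - r)"
    unfolding eq using mink_norm_superadditive[OF f(3) assms(2)] time_foot[OF r] by simp
  also have "\<dots> \<le> cosmological_time D (p + w)"
    using assms f(1) causal_cone_add[OF f(3) assms(2)] unfolding eq[symmetric]
    by (intro time_lower_bound future_closed)
  finally show ?thesis .
qed

text \<open>The time is concave: a convex combination of feet is a competitor for the same
  combination of points, and the reverse triangle inequality compares the lengths. A concave
  function on an open set of a finite-dimensional space is continuous.\<close>

lemma time_continuous_on: "continuous_on D (cosmological_time D)"
proof -
  have "convex_on D (\<lambda>p. - cosmological_time D p)"
  proof (rule convex_onI[OF _ convex_D])
    fix t p q
    assume t: "0 < t" "t < (1::real)" and pq: "p \<in> D" "q \<in> D"
    define r where "r = retraction D p"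
    define s where "s = retraction D q"
    have r: "is_foot p r" and s: "is_foot q s"
      using pq is_foot_retraction by (auto simp: r_def s_def)
    note fr = is_footD[OF r] and fs = is_footD[OF s]
    have conv: "(1 - t) *\<^sub>R r + t *\<^sub>R s \<in> closure D" "(1 - t) *\<^sub>R p + t *\<^sub>R q \<in> D"
      using convex_closure[OF convex_D] convex_D fr(1) fs(1) pq t unfolding convex_alt by auto
    have cone: "(1 - t) *\<^sub>R (p - r) \<in> causal_cone" "t *\<^sub>R (q - s) \<in> causal_cone"
      using fr(3) fs(3) t by (auto intro: causal_cone_scaleR)
    have eq: "(1 - t) *\<^sub>R (p - r) + t *\<^sub>R (q - s)
      = (1 - t) *\<^sub>R p + t *\<^sub>R q - ((1 - t) *\<^sub>R r + t *\<^sub>R s)"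
      by (simp add: algebra_simps)
    have "(1 - t) * cosmological_time D p + t * cosmological_time D q
      \<le> mink_norm ((1 - t) *\<^sub>R (p - r) + t *\<^sub>R (q - s))"
      using mink_norm_superadditive[OF cone] t
      by (simp add: time_foot[OF r] time_foot[OF s] mink_norm_scaleR)
    also have "\<dots> \<le> cosmological_time D ((1 - t) *\<^sub>R p + t *\<^sub>R q)"
      using causal_cone_add[OF cone] conv unfolding eq by (intro time_lower_bound)
    finally show "- cosmological_time D ((1 - t) *\<^sub>R p + t *\<^sub>R q)
      \<le> (1 - t) * - cosmological_time D p + t * - cosmological_time D q"
      by simp
  qed
  from convex_on_continuous[OF open_D this] show ?thesis
    by (auto dest: continuous_on_minus)
qed

subsection \<open>Boundary rays\<close>

lemma support_strict:
  assumes "n \<in> causal_cone" "n \<noteq> 0" "\<And>x. x \<in> closure D \<Longrightarrow> x \<bullet>\<^sub>M n \<le> c" "x \<in> D"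
  shows "x \<bullet>\<^sub>M n < c"
proof -
  obtain t where t: "0 < t" "x + t *\<^sub>R (- time_axis) \<in> D"
    using eventually_line_in_open[OF open_D assms(4)] by (rule eventually_at_right_0_obtain)
  then have "(x + t *\<^sub>R (- time_axis)) \<bullet>\<^sub>M n \<le> c"
    using assms(3) closure_subset by blast
  then have "x \<bullet>\<^sub>M n + t * n $ 1 \<le> c"
    by (simp add: mink_simps)
  moreover have "0 < t * n $ 1"
    using t(1) causal_cone_time_pos[OF assms(1,2)] by simp
  ultimately show ?thesis
    by linarith
qed

text \<open>The past endpoint of a maximal boundary ray, expressed through the lightlike support plane
  which the ray spans.\<close>

definition ray_end :: "minkowski \<Rightarrow> minkowski \<Rightarrow> bool"
  where "ray_end a w \<longleftrightarrow> a \<in> closure D \<and> w \<in> causal_cone \<and> w \<noteq> 0 \<and> w \<bullet>\<^sub>M w = 0 \<and>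
    (\<forall>x\<in>closure D. x \<bullet>\<^sub>M w \<le> a \<bullet>\<^sub>M w) \<and> (\<forall>t>0. a - t *\<^sub>R w \<notin> closure D)"

text \<open>Going back from \<open>q\<close> along \<open>w\<close>, the parameters that stay in the
  closure form a compact set, bounded because causal pasts are; its maximum is the endpoint.\<close>

lemma ray_end_exists:
  assumes "q \<in> closure D" "w \<in> causal_cone" "w \<noteq> 0" "w \<bullet>\<^sub>M w = 0"
    and "\<And>x. x \<in> closure D \<Longrightarrow> x \<bullet>\<^sub>M w \<le> q \<bullet>\<^sub>M w"
  obtains s where "0 \<le> s" "ray_end (q - s *\<^sub>R w) w"
proof -
  define S where "S = {s. 0 \<le> s \<and> q - s *\<^sub>R w \<in> closure D}"
  obtain B where B: "\<And>r. r \<in> closure D \<Longrightarrow> q - r \<in> causal_cone \<Longrightarrow> norm r \<le> B"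
    using causal_past_bounded[of "{q}"] unfolding bounded_iff by auto
  have "\<bar>s\<bar> \<le> (norm q + B) / norm w" if "s \<in> S" for s
  proof -
    have "norm (q - s *\<^sub>R w) \<le> B"
      using that assms(2) by (intro B) (auto simp: S_def causal_cone_scaleR)
    then have "norm (s *\<^sub>R w) \<le> norm q + B"
      using norm_triangle_ineq2[of "s *\<^sub>R w" q] by (simp add: norm_minus_commute)
    then show ?thesis
      using assms(3) by (simp add: pos_le_divide_eq)
  qed
  then have "bounded S"
    unfolding bounded_iff real_norm_def by blast
  moreover have "closed S"
  proof -
    have "closed ((\<lambda>s. q - s *\<^sub>R w) -` closure D)"
      by (intro continuous_closed_vimage closed_closure continuous_intros)
    moreover have "S = {0..} \<inter> (\<lambda>s. q - s *\<^sub>R w) -` closure D"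
      by (auto simp: S_def)
    ultimately show ?thesis
      by auto
  qed
  moreover have "0 \<in> S"
    using assms(1) by (simp add: S_def)
  ultimately obtain s where s: "s \<in> S" "\<And>t. t \<in> S \<Longrightarrow> t \<le> s"
    using compact_attains_sup[of S] by (auto simp: compact_eq_bounded_closed)
  have "q - s *\<^sub>R w - t *\<^sub>R w \<notin> closure D" if "0 < t" for t
  proof
    assume "q - s *\<^sub>R w - t *\<^sub>R w \<in> closure D"
    then have "s + t \<in> S"
      using s(1) that by (simp add: S_def algebra_simps)
    with s(2) that show False
      by fastforce
  qed
  then have "ray_end (q - s *\<^sub>R w) w"
    using s(1) assms by (simp add: ray_end_def S_def mink_simps)
  then show ?thesis
    using s(1) that by (auto simp: S_def)
qed

lemma ray_end_subset_frontier:
  assumes "ray_end a w"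
  shows "ray a w \<subseteq> frontier D"
proof
  fix q
  assume "q \<in> ray a w"
  then obtain s where s: "0 \<le> s" "q = a + s *\<^sub>R w"
    by (auto simp: ray_def)
  have "q \<in> closure D"
    unfolding s(2) using assms s(1)
    by (intro closure_causal_future causal_cone_scaleR) (auto simp: ray_end_def)
  moreover have "q \<bullet>\<^sub>M w = a \<bullet>\<^sub>M w"
    using assms by (simp add: s(2) mink_simps ray_end_def)
  then have "q \<notin> D"
    using assms support_strict[of w "a \<bullet>\<^sub>M w" q] by (auto simp: ray_end_def)
  ultimately show "q \<in> frontier D"
    by (simp add: in_frontier_iff)
qed

lemma frontier_support:
  assumes "q \<in> frontier D"
  obtains n where "n \<in> causal_cone" "n \<noteq> 0" "n \<bullet>\<^sub>M n = 0"
    "\<And>x. x \<in> closure D \<Longrightarrow> x \<bullet>\<^sub>M n \<le> q \<bullet>\<^sub>M n"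
proof -
  obtain n where "n \<in> causal_cone" "n \<noteq> 0" "n \<bullet>\<^sub>M n = 0" "\<And>x. x \<in> D \<Longrightarrow> x \<bullet>\<^sub>M n < q \<bullet>\<^sub>M n"
    using null_support[OF assms] by blast
  then show ?thesis
    using that[of n] closure_mink_le[of D n "q \<bullet>\<^sub>M n"] by force
qed

text \<open>The normal \<open>n\<close> of a lightlike support plane at \<open>q\<close> satisfies
  \<open>n \<bullet>\<^sub>M z \<le> 0\<close> by causality and
  \<open>0 \<le> n \<bullet>\<^sub>M z\<close> because \<open>r\<close> lies in the closure. So
  \<open>n\<close> is orthogonal to the null vector \<open>z\<close>, hence parallel to it, and
  \<open>z\<close> itself is a support direction.\<close>

lemma null_separated_support:
  assumes "q \<in> frontier D" "r \<in> closure D" "q = r + z" "z \<in> causal_cone" "z \<noteq> 0" "z \<bullet>\<^sub>M z = 0"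
    and "x \<in> closure D"
  shows "x \<bullet>\<^sub>M z \<le> r \<bullet>\<^sub>M z"
proof -
  obtain n where n: "n \<in> causal_cone" "n \<noteq> 0" "n \<bullet>\<^sub>M n = 0"
    "\<And>x. x \<in> closure D \<Longrightarrow> x \<bullet>\<^sub>M n \<le> q \<bullet>\<^sub>M n"
    using frontier_support[OF assms(1)] by blast
  have "n \<bullet>\<^sub>M z = 0"
    using n(4)[OF assms(2)] causal_mink_nonpos[OF n(1) assms(4)] assms(3)
    by (simp add: mink_simps mink_commute)
  then obtain k where k: "0 < k" "z = k *\<^sub>R n"
    using null_orthogonal_parallel[OF n(1,3,2) assms(4,6,5)] by blast
  have "k * (x \<bullet>\<^sub>M n) \<le> k * (r \<bullet>\<^sub>M n)"
    using n(3) n(4)[OF assms(7)] k by (intro mult_left_mono) (simp_all add: assms(3) mink_simps)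
  then show ?thesis
    by (simp add: k mink_simps)
qed

lemma frontier_ray_support:
  assumes "ray b z \<subseteq> frontier D" "z \<in> causal_cone" "z \<noteq> 0" "z \<bullet>\<^sub>M z = 0" "x \<in> closure D"
  shows "x \<bullet>\<^sub>M z \<le> b \<bullet>\<^sub>M z"
proof (rule null_separated_support[OF _ _ refl assms(2-5)])
  have "b + s *\<^sub>R z \<in> frontier D" if "0 \<le> s" for s
    using assms(1) that by (auto simp: ray_def)
  from this[of 0] this[of 1] show "b + z \<in> frontier D" "b \<in> closure D"
    by (simp_all add: in_frontier_iff)
qed

text \<open>Replaces a quantification over all rays by a condition on a single line. A larger ray
  contains \<open>a\<close> and \<open>a + w\<close>, so it is parallel to \<open>w\<close> and its
  origin would lie behind \<open>a\<close>; conversely the end found by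
  \<open>ray_end_exists\<close> extends the ray unless it is already \<open>a\<close>.\<close>

lemma maximal_boundary_ray_iff: "maximal_boundary_ray D a w \<longleftrightarrow> ray_end a w"
proof
  assume max: "maximal_boundary_ray D a w"
  then have w: "w \<in> causal_cone" "w \<noteq> 0" "w \<bullet>\<^sub>M w = 0" and sub: "ray a w \<subseteq> frontier D"
    unfolding maximal_boundary_ray_def using lightlike_future_iff by blast+
  have "a + 0 *\<^sub>R w \<in> ray a w"
    unfolding ray_def by blast
  then have "a \<in> closure D"
    using sub by (auto simp: in_frontier_iff)
  then obtain s where s: "0 \<le> s" "ray_end (a - s *\<^sub>R w) w"
    using ray_end_exists[of a w] frontier_ray_support[OF sub w] w by blast
  have "ray a w \<subseteq> ray (a - s *\<^sub>R w) w"
  proof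
    fix q
    assume "q \<in> ray a w"
    then obtain t where "0 \<le> t" "q = a + t *\<^sub>R w"
      by (auto simp: ray_def)
    then have "0 \<le> t + s" "q = a - s *\<^sub>R w + (t + s) *\<^sub>R w"
      using s by (simp_all add: algebra_simps)
    then show "q \<in> ray (a - s *\<^sub>R w) w"
      unfolding ray_def by blast
  qed
  moreover have "lightlike w \<and> future_directed w"
    using w lightlike_future_iff by blast
  ultimately have "ray (a - s *\<^sub>R w) w = ray a w"
    using max ray_end_subset_frontier[OF s(2)] unfolding maximal_boundary_ray_def by blast
  moreover have "a - s *\<^sub>R w + 0 *\<^sub>R w \<in> ray (a - s *\<^sub>R w) w"
    unfolding ray_def by blast
  ultimately obtain t where "0 \<le> t" "a - s *\<^sub>R w = a + t *\<^sub>R w"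
    by (auto simp: ray_def)
  then have "(s + t) *\<^sub>R w = 0"
    by (simp add: algebra_simps)
  then have "s = 0"
    using w s(1) \<open>0 \<le> t\<close> by simp
  with s show "ray_end a w"
    by simp
next
  assume a: "ray_end a w"
  then have w: "lightlike w \<and> future_directed w"
    using lightlike_future_iff by (auto simp: ray_end_def)
  have "ray b z = ray a w"
    if z: "lightlike z \<and> future_directed z" and sub: "ray b z \<subseteq> frontier D" "ray a w \<subseteq> ray b z" for b z
  proof -
    have "a + 0 *\<^sub>R w \<in> ray a w" "a + 1 *\<^sub>R w \<in> ray a w"
      unfolding ray_def by (blast intro: zero_le_one)+
    then have "a \<in> ray b z" "a + w \<in> ray b z"
      using sub(2) by auto
    then obtain s t where st: "0 \<le> s" "a = b + s *\<^sub>R z" "0 \<le> t" "a + w = b + t *\<^sub>R z"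
      unfolding ray_def by blast
    then have wz: "w = (t - s) *\<^sub>R z"
      by (simp add: algebra_simps)
    have "s < t"
      using w z unfolding wz by (auto simp: future_directed_def zero_less_mult_iff)
    have "b + 0 *\<^sub>R z \<in> ray b z"
      unfolding ray_def by blast
    then have "b \<in> closure D"
      using sub(1) by (auto simp: in_frontier_iff)
    moreover have "b = a - (s / (t - s)) *\<^sub>R w"
      using \<open>s < t\<close> by (simp add: st(2) wz)
    ultimately have "\<not> 0 < s / (t - s)"
      using a unfolding ray_end_def by metis
    then have "s = 0"
      using st(1) \<open>s < t\<close> by (auto simp: zero_less_divide_iff)
    show ?thesis
    proof (rule antisym[OF _ sub(2)], rule subsetI)
      fix q
      assume "q \<in> ray b z"
      then obtain r where "0 \<le> r" "q = b + r *\<^sub>R z"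
        by (auto simp: ray_def)
      then have "0 \<le> r / t" "q = a + (r / t) *\<^sub>R w"
        using \<open>s < t\<close> by (simp_all add: st(2) wz \<open>s = 0\<close>)
      then show "q \<in> ray a w"
        unfolding ray_def by blast
    qed
  qed
  then show "maximal_boundary_ray D a w"
    using w ray_end_subset_frontier[OF a] unfolding maximal_boundary_ray_def by blast
qed

text \<open>Each endpoint satisfies the support inequality of the other ray. Unless \<open>q\<close>
  is both endpoints, evaluation at \<open>q\<close> makes \<open>w \<bullet>\<^sub>M z\<close>
  nonnegative, so the null directions are parallel; two endpoints on one line coincide, as neither
  can lie behind the other.\<close>

lemma ray_end_unique:
  assumes a: "ray_end a w" and b: "ray_end b z" and q: "q \<in> ray a w" "q \<in> ray b z"
  shows "a = b"
proof -
  obtain s t where st: "0 \<le> s" "q = a + s *\<^sub>R w" "0 \<le> t" "q = b + t *\<^sub>R z"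
    using q unfolding ray_def by blast
  show ?thesis
  proof (cases "s = 0 \<and> t = 0")
    case True
    with st show ?thesis by simp
  next
    case False
    have le: "w \<bullet>\<^sub>M z \<le> 0"
      using a b by (intro causal_mink_nonpos) (auto simp: ray_end_def)
    have "a \<bullet>\<^sub>M z \<le> b \<bullet>\<^sub>M z" "b \<bullet>\<^sub>M w \<le> a \<bullet>\<^sub>M w" "z \<bullet>\<^sub>M z = 0" "w \<bullet>\<^sub>M w = 0"
      using a b by (auto simp: ray_end_def)
    moreover have "(a + s *\<^sub>R w) \<bullet>\<^sub>M z = (b + t *\<^sub>R z) \<bullet>\<^sub>M z" "(a + s *\<^sub>R w) \<bullet>\<^sub>M w = (b + t *\<^sub>R z) \<bullet>\<^sub>M w"
      using st(2,4) by metis+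
    ultimately have "0 \<le> s * (w \<bullet>\<^sub>M z)" "0 \<le> t * (w \<bullet>\<^sub>M z)"
      by (simp_all add: mink_simps mink_commute[of z w])
    moreover have "0 < s \<or> 0 < t"
      using False st(1,3) by auto
    ultimately have "w \<bullet>\<^sub>M z = 0"
      using le by (auto simp only: zero_le_mult_iff)
    then obtain k where k: "0 < k" "z = k *\<^sub>R w"
      using null_orthogonal_parallel[of w z] a b unfolding ray_end_def by metis
    have "a + s *\<^sub>R w = b + t *\<^sub>R z"
      using st(2,4) by metis
    moreover have "((s - t * k) / k) *\<^sub>R z = (s - t * k) *\<^sub>R w"
      using k by simp
    ultimately have eq: "b = a - (t * k - s) *\<^sub>R w" "a = b - ((s - t * k) / k) *\<^sub>R z"
      by (simp_all only:) (simp_all add: k(2) algebra_simps)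
    have "\<not> 0 < t * k - s" "\<not> 0 < (s - t * k) / k"
      using a b eq unfolding ray_end_def by metis+
    then have "t * k - s = 0"
      using k(1) by (auto simp: zero_less_divide_iff)
    with eq(1) show ?thesis
      by simp
  qed
qed

lemma retraction0_ray_end:
  assumes "ray_end a w" "q \<in> ray a w"
  shows "retraction0 D q = a"
  unfolding retraction0_def maximal_boundary_ray_iff
  using assms ray_end_unique by (intro the_equality) blast+

lemma frontier_ray_end:
  assumes "q \<in> frontier D"
  obtains w where "ray_end (retraction0 D q) w" "q \<in> ray (retraction0 D q) w"
proof -
  obtain n where n: "n \<in> causal_cone" "n \<noteq> 0" "n \<bullet>\<^sub>M n = 0"
    "\<And>x. x \<in> closure D \<Longrightarrow> x \<bullet>\<^sub>M n \<le> q \<bullet>\<^sub>M n"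
    using frontier_support[OF assms] by blast
  moreover have "q \<in> closure D"
    using assms by (simp add: in_frontier_iff)
  ultimately obtain s where s: "0 \<le> s" "ray_end (q - s *\<^sub>R n) n"
    using ray_end_exists[of q n] by blast
  have "q = q - s *\<^sub>R n + s *\<^sub>R n"
    by simp
  then have "q \<in> ray (q - s *\<^sub>R n) n"
    using s(1) unfolding ray_def by blast
  with s show ?thesis
    using that[of n] retraction0_ray_end[OF s(2)] by simp
qed

lemma retraction0_in_frontier: "q \<in> frontier D \<Longrightarrow> retraction0 D q \<in> frontier D"
proof -
  assume "q \<in> frontier D"
  then obtain w where "ray_end (retraction0 D q) w"
    using frontier_ray_end by blast
  moreover have "retraction0 D q + 0 *\<^sub>R w \<in> ray (retraction0 D q) w"
    unfolding ray_def by blast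
  ultimately show ?thesis
    using ray_end_subset_frontier by fastforce
qed

lemma retraction0_causal:
  assumes "q \<in> frontier D"
  shows "q - retraction0 D q \<in> causal_cone"
proof -
  obtain w where w: "ray_end (retraction0 D q) w" "q \<in> ray (retraction0 D q) w"
    using frontier_ray_end[OF assms] by blast
  from w(2) obtain s where "0 \<le> s" "q = retraction0 D q + s *\<^sub>R w"
    unfolding ray_def by blast
  then show ?thesis
    using w(1) causal_cone_scaleR[of w s] unfolding ray_end_def by (metis add_diff_cancel_left')
qed

section \<open>The causal past of a boundary point, and feet as endpoints of rays\<close>

lemma frontier_causal_past:
  assumes "q \<in> frontier D" "r \<in> closure D" "q - r \<in> causal_cone"
  shows "(q - r) \<bullet>\<^sub>M (q - r) = 0"
proof (rule ccontr)
  assume "(q - r) \<bullet>\<^sub>M (q - r) \<noteq> 0"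
  then have "q - r \<in> timelike_cone"
    using assms(3) causal_cone_time_pos[of "q - r"] minkowski.zero_left
    by (cases "q = r") (auto simp: causal_cone_def timelike_cone_def)
  then have "q \<in> D"
    using closure_timelike_future[OF assms(2)] by fastforce
  with assms(1) show False
    by (simp add: in_frontier_iff)
qed

text \<open>The vector \<open>q - r\<close> is null and orthogonal to the lightlike support direction at \<open>q\<close>, so \<open>r\<close> lies
  on the boundary ray through \<open>q\<close>.\<close>

lemma retraction0_causal_past:
  assumes q: "q \<in> frontier D" and r: "r \<in> closure D" and qr: "q - r \<in> causal_cone"
  shows "retraction0 D r = retraction0 D q"
proof (cases "q = r")
  case False
  define z where "z = q - r"
  have z: "z \<in> causal_cone" "z \<noteq> 0" "z \<bullet>\<^sub>M z = 0" "q = r + z"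
    using False qr frontier_causal_past[OF assms] by (auto simp: z_def)
  then obtain s where s: "0 \<le> s" "ray_end (r - s *\<^sub>R z) z"
    using ray_end_exists[OF r z(1,2,3)] null_separated_support[OF q r z(4,1,2,3)] by blast
  have "r = r - s *\<^sub>R z + s *\<^sub>R z" "q = r - s *\<^sub>R z + (s + 1) *\<^sub>R z"
    by (simp_all add: z(4) algebra_simps)
  moreover have "0 \<le> s + 1"
    using s(1) by simp
  ultimately have "r \<in> ray (r - s *\<^sub>R z) z" "q \<in> ray (r - s *\<^sub>R z) z"
    using s(1) unfolding ray_def by blast+
  then show ?thesis
    using retraction0_ray_end[OF s(2)] by simp
qed simp

lemma retraction0_idem: "q \<in> frontier D \<Longrightarrow> retraction0 D (retraction0 D q) = retraction0 D q"
  using retraction0_causal_past[of q "retraction0 D q"] retraction0_in_frontier[of q]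
    retraction0_causal[of q] by (auto simp: in_frontier_iff)

text \<open>If \<open>r\<close> had parameter \<open>s > 0\<close> on its boundary ray, the product
  of \<open>retraction0 D r - r\<close> with \<open>p - r\<close> would be
  \<open>- s * (w \<bullet>\<^sub>M (p - r))\<close>, which is positive: the endpoint would violate
  the spacelike support plane at \<open>r\<close>.\<close>

lemma retraction0_foot:
  assumes "is_foot p r"
  shows "retraction0 D r = r"
proof -
  note f = is_footD[OF assms]
  obtain w where w: "ray_end (retraction0 D r) w" "r \<in> ray (retraction0 D r) w"
    using frontier_ray_end[OF foot_frontier[OF assms]] by blast
  from w(2) obtain s where s: "0 \<le> s" "r = retraction0 D r + s *\<^sub>R w"
    unfolding ray_def by blast
  have "(retraction0 D r - r) \<bullet>\<^sub>M (p - r) \<le> 0"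
    using w(1) by (intro f(4)) (simp add: ray_end_def)
  moreover have "retraction0 D r - r = - s *\<^sub>R w"
    using s(2) by (metis add_diff_cancel_left' minus_diff_eq scaleR_minus_left)
  then have "(retraction0 D r - r) \<bullet>\<^sub>M (p - r) = - s * (w \<bullet>\<^sub>M (p - r))"
    by (simp only: minkowski.scaleR_left real_scaleR_def)
  ultimately have "0 \<le> s * ((p - r) \<bullet>\<^sub>M w)"
    by (simp add: mink_commute[of w "p - r"])
  moreover have "(p - r) \<bullet>\<^sub>M w < 0"
    using w(1) by (intro timelike_mink_neg f) (auto simp: ray_end_def)
  ultimately have "s = 0"
    using s(1) by (auto simp: zero_le_mult_iff)
  with s(2) show ?thesis
    by simp
qed

lemma singularity_frontier: "initial_singularity D \<subseteq> frontier D"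
  using is_foot_retraction foot_frontier by (auto simp: initial_singularity_def)

lemma retraction0_singularity: "r \<in> initial_singularity D \<Longrightarrow> retraction0 D r = r"
  using is_foot_retraction retraction0_foot by (auto simp: initial_singularity_def)

lemma singularity_subset_extended: "initial_singularity D \<subseteq> extended_singularity D"
  using singularity_frontier retraction0_singularity unfolding extended_singularity_def
  by (metis imageI subsetD subsetI)

subsection \<open>Limits of points in the causal past\<close>

lemma causal_past_limit:
  assumes q: "q \<in> frontier D" and p: "p \<longlonglongrightarrow> q"
    and r: "\<And>k::nat. r k \<in> closure D" "\<And>k. p k - r k \<in> causal_cone"
  obtains l f where "strict_mono f" "(r \<circ> f) \<longlonglongrightarrow> l" "l \<in> closure D" "q - l \<in> causal_cone"
proof -
  have "bounded (range p)"
    using p by (rule convergent_imp_bounded)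
  from causal_past_bounded[OF this] have "bounded (range r)"
    by (rule bounded_subset) (use r in auto)
  then obtain l f where lf: "strict_mono f" "(r \<circ> f) \<longlonglongrightarrow> l"
    using bounded_imp_convergent_subsequence by blast
  have "l \<in> closure D"
    using closed_sequentially[OF closed_closure _ lf(2)] r by simp
  moreover have "(\<lambda>k. (p \<circ> f) k - (r \<circ> f) k) \<longlonglongrightarrow> q - l"
    using LIMSEQ_subseq_LIMSEQ[OF p lf(1)] lf(2) by (rule tendsto_diff)
  then have "q - l \<in> causal_cone"
    using closed_sequentially[OF closed_causal_cone, of "\<lambda>k. (p \<circ> f) k - (r \<circ> f) k"] r(2) by simp
  ultimately show ?thesis
    using that lf by blast
qed

text \<open>Along \<open>v\<close> the feet subconverge to a point \<open>l\<close> of the closure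
  in the causal past of \<open>q\<close>; as \<open>q - l\<close> is null or 0, the distances to the
  feet tend to 0 along the subsequence. This starts the intermediate value argument on vertical
  lines.\<close>

lemma time_small_near_frontier:
  assumes q: "q \<in> frontier D" and v: "v \<in> timelike_cone" and e: "0 < e"
  obtains t where "0 < t" "cosmological_time D (q + t *\<^sub>R v) < e"
proof -
  define p where "p k = q + (1 / real (Suc k)) *\<^sub>R v" for k
  define r where "r k = retraction D (p k)" for k
  have "p k \<in> D" for k
    unfolding p_def using q v by (intro closure_timelike_future timelike_cone_scaleR) (auto simp: in_frontier_iff)
  then have f: "is_foot (p k) (r k)" for k
    by (simp add: r_def is_foot_retraction)
  have "(\<lambda>k. 1 / real (Suc k)) \<longlonglongrightarrow> 0"
    using LIMSEQ_inverse_real_of_nat by (simp add: inverse_eq_divide)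
  then have "(\<lambda>k. q + (1 / real (Suc k)) *\<^sub>R v) \<longlonglongrightarrow> q + 0 *\<^sub>R v"
    by (intro tendsto_intros)
  then have p: "p \<longlonglongrightarrow> q"
    by (simp add: p_def[abs_def])
  obtain l g where g: "strict_mono g" "(r \<circ> g) \<longlonglongrightarrow> l" "l \<in> closure D" "q - l \<in> causal_cone"
    using causal_past_limit[OF q p, of r] is_footD[OF f] by metis
  have "(\<lambda>k. mink_norm ((p \<circ> g) k - (r \<circ> g) k)) \<longlonglongrightarrow> mink_norm (q - l)"
    unfolding mink_norm_def
    by (intro tendsto_intros minkowski.tendsto LIMSEQ_subseq_LIMSEQ[OF p g(1)] g(2))
  moreover have "mink_norm (q - l) = 0"
    using frontier_causal_past[OF q g(3,4)] by (simp add: mink_norm_def)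
  ultimately have "\<forall>\<^sub>F k in sequentially. mink_norm ((p \<circ> g) k - (r \<circ> g) k) < e"
    using e by (intro order_tendstoD) auto
  then obtain k where "mink_norm (p (g k) - r (g k)) < e"
    by (auto dest: eventually_happens)
  then have "cosmological_time D (p (g k)) < e"
    using time_foot[OF f] by simp
  then show ?thesis
    using that[of "1 / real (Suc (g k))"] by (simp add: p_def)
qed

text \<open>Any limit of the points \<open>r\<close> lies on the boundary ray through \<open>q\<close> and in the closed set \<open>T\<close>,
  but \<open>T\<close> contains no point of that ray except possibly its endpoint.\<close>

lemma singularity_near_retraction0:
  assumes T: "closed (initial_singularity D)" and q: "q \<in> frontier D" and e: "0 < e"
  obtains d where "0 < d"
    "\<And>p r. dist p q < d \<Longrightarrow> r \<in> initial_singularity D \<Longrightarrow> p - r \<in> causal_cone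
      \<Longrightarrow> dist r (retraction0 D q) < e"
proof (rule ccontr)
  assume "\<not> thesis"
  then have "\<exists>p r. dist p q < 1 / real (Suc k) \<and> r \<in> initial_singularity D \<and> p - r \<in> causal_cone \<and>
      \<not> dist r (retraction0 D q) < e" for k
    using that[of "1 / real (Suc k)"] by fastforce
  then obtain p r where pr: "\<And>k. dist (p k) q < 1 / real (Suc k)"
    "\<And>k. r k \<in> initial_singularity D" "\<And>k. p k - r k \<in> causal_cone"
    "\<And>k. \<not> dist (r k) (retraction0 D q) < e"
    by metis
  have "(\<lambda>k. 1 / real (Suc k)) \<longlonglongrightarrow> 0"
    using LIMSEQ_inverse_real_of_nat by (simp add: inverse_eq_divide)
  then have p: "p \<longlonglongrightarrow> q"
    by (rule metric_tendsto_imp_tendsto) (use pr(1) in \<open>auto intro!: always_eventually less_imp_le\<close>)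
  have "r k \<in> closure D" for k
    using subsetD[OF singularity_frontier pr(2)[of k]] by (simp add: in_frontier_iff)
  then obtain l f where f: "strict_mono f" "(r \<circ> f) \<longlonglongrightarrow> l" "l \<in> closure D" "q - l \<in> causal_cone"
    using causal_past_limit[OF q p, of r] pr(3) by metis
  have "l \<in> initial_singularity D"
    using closed_sequentially[OF T _ f(2)] pr(2) by simp
  then have "l = retraction0 D q"
    using retraction0_causal_past[OF q f(3,4)] retraction0_singularity by simp
  with tendstoD[OF f(2) e] have "\<forall>\<^sub>F k in sequentially. dist ((r \<circ> f) k) (retraction0 D q) < e"
    by simp
  with pr(4) show False
    by simp
qed

section \<open>Consequences of closedness: convergence, equality of the singularities,
  continuity\<close>

lemma singularity_tendsto_retraction0:
  assumes "closed (initial_singularity D)" "q \<in> frontier D" "(p \<longlongrightarrow> q) F"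
    and r: "\<forall>\<^sub>F x in F. r x \<in> initial_singularity D \<and> p x - r x \<in> causal_cone"
  shows "(r \<longlongrightarrow> retraction0 D q) F"
proof (rule tendstoI)
  fix e :: real
  assume "0 < e"
  with assms(1,2) obtain d where "0 < d" and d: "\<And>p r. dist p q < d \<Longrightarrow>
      r \<in> initial_singularity D \<Longrightarrow> p - r \<in> causal_cone \<Longrightarrow> dist r (retraction0 D q) < e"
    by (rule singularity_near_retraction0) blast
  from tendstoD[OF assms(3) \<open>0 < d\<close>] r show "\<forall>\<^sub>F x in F. dist (r x) (retraction0 D q) < e"
    by eventually_elim (use d in blast)
qed

lemma singularity_eq_extended:
  assumes T: "closed (initial_singularity D)"
  shows "initial_singularity D = extended_singularity D"
proof (rule antisym[OF singularity_subset_extended], rule subsetI)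
  fix a
  assume "a \<in> extended_singularity D"
  then have a: "a \<in> frontier D" "retraction0 D a = a"
    using retraction0_in_frontier retraction0_idem by (auto simp: extended_singularity_def)
  have D: "a + t *\<^sub>R time_axis \<in> D" if "0 < t" for t
    using a that by (intro closure_timelike_future timelike_cone_scaleR) (auto simp: in_frontier_iff)
  have "((\<lambda>t. a + t *\<^sub>R time_axis) \<longlongrightarrow> a + 0 *\<^sub>R time_axis) (at_right 0)"
    by (intro tendsto_intros)
  then have "((\<lambda>t. a + t *\<^sub>R time_axis) \<longlongrightarrow> a) (at_right 0)"
    by simp
  moreover have "\<forall>\<^sub>F t in at_right 0. retraction D (a + t *\<^sub>R time_axis) \<in> initial_singularity D \<and>
      a + t *\<^sub>R time_axis - retraction D (a + t *\<^sub>R time_axis) \<in> causal_cone"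
    using eventually_at_right_less[of "0::real"]
    by eventually_elim
      (use D is_footD(3)[OF is_foot_retraction] in \<open>auto simp: initial_singularity_def\<close>)
  ultimately have "((\<lambda>t. retraction D (a + t *\<^sub>R time_axis)) \<longlongrightarrow> retraction0 D a) (at_right 0)"
    using T a by (intro singularity_tendsto_retraction0)
  moreover have "\<forall>\<^sub>F t in at_right 0. retraction D (a + t *\<^sub>R time_axis) \<in> initial_singularity D"
    using eventually_at_right_less[of "0::real"]
    by eventually_elim (use D in \<open>auto simp: initial_singularity_def\<close>)
  ultimately have "retraction0 D a \<in> initial_singularity D"
    using T by (intro Lim_in_closed_set[where F = "at_right (0::real)"]) auto
  with a show "a \<in> initial_singularity D"
    by simp
qed

lemma retraction0_continuous_on:
  assumes T: "closed (initial_singularity D)"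
  shows "continuous_on (frontier D) (retraction0 D)"
  unfolding continuous_on_def
proof
  fix q
  assume q: "q \<in> frontier D"
  \<comment> \<open>The values of \<open>retraction0\<close> lie in the extended singularity;
    \<open>singularity_eq_extended\<close> is what places them in
    \<open>initial_singularity D\<close>.\<close>
  have "\<forall>\<^sub>F x in at q within frontier D. retraction0 D x \<in> initial_singularity D \<and>
      x - retraction0 D x \<in> causal_cone"
    using singularity_eq_extended[OF T] retraction0_causal
    by (auto simp: eventually_at_filter extended_singularity_def)
  with T q show "(retraction0 D \<longlongrightarrow> retraction0 D q) (at q within frontier D)"
    by (intro singularity_tendsto_retraction0[where p = "\<lambda>x. x"]) (auto intro: tendsto_ident_at)
qed

subsection \<open>Graphs\<close>

text \<open>The heights \<open>A\<close> of the points in \<open>D\<close> form an up-set, bounded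
  below by the spacelike plane of \<open>timelike_bound\<close> and without a least element because
  \<open>D\<close> is open; \<open>s0\<close> is the infimum.\<close>

lemma vertical_line_domain:
  assumes v: "v \<in> timelike_cone"
  obtains s0 where "x + s0 *\<^sub>R v \<in> frontier D" "\<And>s. x + s *\<^sub>R v \<in> D \<longleftrightarrow> s0 < s"
proof -
  define A where "A = {s. x + s *\<^sub>R v \<in> D}"
  have up: "t \<in> A" if "s \<in> A" "s \<le> t" for s t
  proof -
    have "x + s *\<^sub>R v + (t - s) *\<^sub>R v \<in> D"
      using that v timelike_subset_causal
      by (intro future_closed[of "x + s *\<^sub>R v"] causal_cone_scaleR) (auto simp: A_def)
    then show ?thesis
      by (simp add: A_def algebra_simps)
  qed
  obtain d where "d \<in> D"
    using nonempty by blast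
  \<comment> \<open>Scaled by \<open>1 / t\<close>, this vector is
    \<open>x + (1 / t) *\<^sub>R v - d\<close>, so the line enters the future of
    \<open>d\<close>.\<close>
  obtain t where t: "0 < t" "v + t *\<^sub>R (x - d) \<in> timelike_cone"
    using eventually_line_in_open[OF open_timelike_cone v] by (rule eventually_at_right_0_obtain)
  have "d + (1 / t) *\<^sub>R (v + t *\<^sub>R (x - d)) \<in> D"
    using t \<open>d \<in> D\<close> timelike_cone_scaleR[OF t(2), of "1 / t"] timelike_subset_causal
    by (intro future_closed) auto
  moreover have "d + (1 / t) *\<^sub>R (v + t *\<^sub>R (x - d)) = x + (1 / t) *\<^sub>R v"
    using t(1) by (simp add: algebra_simps)
  ultimately have "1 / t \<in> A"
    by (simp add: A_def)
  then have "A \<noteq> {}"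
    by blast
  have "bdd_below A"
  proof -
    obtain m c where m: "m \<in> timelike_cone" and c: "\<And>x. x \<in> D \<Longrightarrow> x \<bullet>\<^sub>M m \<le> c"
      using timelike_bound by blast
    have neg: "v \<bullet>\<^sub>M m < 0"
      using v m timelike_subset_causal timelike_cone_nonzero by (intro timelike_mink_neg) auto
    have "(x \<bullet>\<^sub>M m - c) / - (v \<bullet>\<^sub>M m) \<le> s" if "s \<in> A" for s
    proof -
      have "x \<bullet>\<^sub>M m - c \<le> s * - (v \<bullet>\<^sub>M m)"
        using that c[of "x + s *\<^sub>R v"] by (simp add: A_def mink_simps)
      with neg show ?thesis
        by (subst pos_divide_le_eq) auto
    qed
    then show ?thesis
      by (rule bdd_belowI)
  qed
  define s0 where "s0 = Inf A"
  have above: "s \<in> A" if "s0 < s" for s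
    using that up cInf_lessD[OF \<open>A \<noteq> {}\<close>] unfolding s0_def by (metis less_imp_le)
  have "s0 \<notin> A"
  proof
    assume "s0 \<in> A"
    then have "x + s0 *\<^sub>R v \<in> D"
      by (simp add: A_def)
    from eventually_line_in_open[OF open_D this]
    obtain t where "0 < t" "x + s0 *\<^sub>R v + t *\<^sub>R (- v) \<in> D"
      by (rule eventually_at_right_0_obtain)
    then have "s0 - t \<in> A" "s0 - t < s0"
      by (simp_all add: A_def algebra_simps)
    then show False
      using cInf_lower[OF _ \<open>bdd_below A\<close>, of "s0 - t"] unfolding s0_def by linarith
  qed
  have iff: "x + s *\<^sub>R v \<in> D \<longleftrightarrow> s0 < s" for s
    using above up \<open>s0 \<notin> A\<close> unfolding A_def by (metis mem_Collect_eq not_le)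
  have "\<forall>\<^sub>F s in at_right s0. x + s *\<^sub>R v \<in> closure D"
    using eventually_at_right_less[of s0]
    by eventually_elim (use iff closure_subset in blast)
  moreover have "((\<lambda>s. x + s *\<^sub>R v) \<longlongrightarrow> x + s0 *\<^sub>R v) (at_right s0)"
    by (intro tendsto_intros)
  ultimately have "x + s0 *\<^sub>R v \<in> closure D"
    by (intro Lim_in_closed_set[where F = "at_right s0"]) auto
  with iff have "x + s0 *\<^sub>R v \<in> frontier D"
    by (simp add: in_frontier_iff)
  with iff show ?thesis
    using that by blast
qed

lemma frontier_vertical_unique:
  assumes "v \<in> timelike_cone" "x + s *\<^sub>R v \<in> frontier D" "x + t *\<^sub>R v \<in> frontier D"
  shows "s = t"
proof -
  have le: "t \<le> s" if "x + s *\<^sub>R v \<in> frontier D" "x + t *\<^sub>R v \<in> frontier D" for s t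
  proof (rule ccontr)
    assume "\<not> t \<le> s"
    then have "x + s *\<^sub>R v + (t - s) *\<^sub>R v \<in> D"
      using that assms(1)
      by (intro closure_timelike_future timelike_cone_scaleR) (auto simp: in_frontier_iff)
    then show False
      using that by (simp add: in_frontier_iff algebra_simps)
  qed
  from le[OF assms(2,3)] le[OF assms(3,2)] show ?thesis
    by simp
qed

lemma frontier_height_eqI:
  assumes "v \<in> timelike_cone" "x + s *\<^sub>R v \<in> frontier D"
  shows "graph_height (frontier D) v x = s"
  unfolding graph_height_def using assms frontier_vertical_unique by (intro the_equality) auto

lemma
  assumes v: "v \<in> timelike_cone"
  shows frontier_point: "graph_point (frontier D) v x \<in> frontier D"
    and domain_above_frontier: "x + s *\<^sub>R v \<in> D \<longleftrightarrow> graph_height (frontier D) v x < s"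
proof -
  obtain s0 where s0: "x + s0 *\<^sub>R v \<in> frontier D" "\<And>s. x + s *\<^sub>R v \<in> D \<longleftrightarrow> s0 < s"
    using vertical_line_domain[OF v] by blast
  have "graph_height (frontier D) v x = s0"
    using v s0(1) by (rule frontier_height_eqI)
  with s0 show "graph_point (frontier D) v x \<in> frontier D"
    "x + s *\<^sub>R v \<in> D \<longleftrightarrow> graph_height (frontier D) v x < s"
    by (simp_all add: graph_point_def)
qed

lemma frontier_height_le:
  assumes v: "v \<in> timelike_cone" and "x + s *\<^sub>R v \<in> closure D"
  shows "graph_height (frontier D) v x \<le> s"
proof (rule field_le_epsilon)
  fix e :: real
  assume "0 < e"
  then have "x + s *\<^sub>R v + e *\<^sub>R v \<in> D"
    using assms by (intro closure_timelike_future timelike_cone_scaleR)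
  then have "x + (s + e) *\<^sub>R v \<in> D"
    by (simp add: algebra_simps)
  then show "graph_height (frontier D) v x \<le> s + e"
    using domain_above_frontier[OF v] by (simp add: less_imp_le)
qed

section \<open>Level surfaces as graphs along a timelike direction\<close>

lemma time_vertical:
  assumes "v \<in> timelike_cone" "x + s *\<^sub>R v \<in> D" "s \<le> t"
  shows "cosmological_time D (x + s *\<^sub>R v) + (t - s) * mink_norm v \<le> cosmological_time D (x + t *\<^sub>R v)"
proof -
  have "(t - s) *\<^sub>R v \<in> causal_cone"
    using assms timelike_subset_causal by (auto intro: causal_cone_scaleR)
  moreover have "x + s *\<^sub>R v + (t - s) *\<^sub>R v = x + t *\<^sub>R v"
    by (simp add: algebra_simps)
  ultimately show ?thesis
    using time_increasing[OF assms(2), of "(t - s) *\<^sub>R v"] assms(3)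
    by (simp only: mink_norm_scaleR diff_ge_0_iff_ge)
qed

lemma level_vertical_unique:
  assumes v: "v \<in> timelike_cone"
    and "x + s *\<^sub>R v \<in> level_surface D \<epsilon>" "x + t *\<^sub>R v \<in> level_surface D \<epsilon>"
  shows "s = t"
proof -
  have "\<not> s < t" if "x + s *\<^sub>R v \<in> level_surface D \<epsilon>" "x + t *\<^sub>R v \<in> level_surface D \<epsilon>" for s t
  proof
    assume "s < t"
    then have "0 < (t - s) * mink_norm v"
      using mink_norm_pos[OF v] by simp
    with time_vertical[OF v, of x s t] \<open>s < t\<close> that show False
      by (simp add: level_surface_def)
  qed
  from this[OF assms(2,3)] this[OF assms(3,2)] show ?thesis
    by simp
qed

lemma level_vertical_exists:
  assumes v: "v \<in> timelike_cone" and \<epsilon>: "0 < \<epsilon>"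
  obtains s where "x + s *\<^sub>R v \<in> level_surface D \<epsilon>"
proof -
  define h where "h = graph_height (frontier D) v x"
  define f where "f s = cosmological_time D (x + s *\<^sub>R v)" for s
  have D: "x + s *\<^sub>R v \<in> D \<longleftrightarrow> h < s" for s
    using domain_above_frontier[OF v] by (simp add: h_def)
  obtain t where t: "0 < t" "cosmological_time D (x + h *\<^sub>R v + t *\<^sub>R v) < \<epsilon>"
    using time_small_near_frontier[OF frontier_point[OF v] v \<epsilon>]
    unfolding graph_point_def h_def by blast
  define s1 where "s1 = h + t"
  define s2 where "s2 = s1 + \<epsilon> / mink_norm v"
  have s1: "h < s1" "f s1 \<le> \<epsilon>"
    using t by (simp_all add: s1_def f_def algebra_simps)
  have "s1 \<le> s2"
    using \<epsilon> mink_norm_pos[OF v] by (simp add: s2_def)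
  then have "f s1 + \<epsilon> \<le> f s2"
    using time_vertical[OF v, of x s1 s2] D[of s1] s1(1) mink_norm_pos[OF v]
    by (simp add: f_def s2_def)
  moreover have "0 < f s1"
    unfolding f_def using D s1(1) by (intro time_pos) blast
  ultimately have "\<epsilon> \<le> f s2"
    by linarith
  moreover have "continuous_on {s1..s2} f"
  proof -
    have "continuous_on {s1..s2} (\<lambda>s. x + s *\<^sub>R v)"
      by (intro continuous_intros)
    moreover have "(\<lambda>s. x + s *\<^sub>R v) ` {s1..s2} \<subseteq> D"
      using D s1(1) by force
    ultimately show ?thesis
      unfolding f_def by (rule continuous_on_compose2[OF time_continuous_on])
  qed
  ultimately obtain s where "s1 \<le> s" "f s = \<epsilon>"
    using IVT'[of f s1 \<epsilon> s2] s1(2) \<open>s1 \<le> s2\<close> by blast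
  then have "x + s *\<^sub>R v \<in> level_surface D \<epsilon>"
    using D s1(1) by (simp add: level_surface_def f_def)
  then show ?thesis
    by (rule that)
qed

lemma level_height_eqI:
  assumes "v \<in> timelike_cone" "x + s *\<^sub>R v \<in> level_surface D \<epsilon>"
  shows "graph_height (level_surface D \<epsilon>) v x = s"
  unfolding graph_height_def using assms level_vertical_unique by (intro the_equality) auto

lemma level_point:
  assumes "v \<in> timelike_cone" "0 < \<epsilon>"
  shows "graph_point (level_surface D \<epsilon>) v x \<in> level_surface D \<epsilon>"
  using level_vertical_exists[OF assms] level_height_eqI[OF assms(1)]
  unfolding graph_point_def by metis

text \<open>The boundary point below is a competitor for the level point, so their separation, a
  positive multiple of the unit vector \<open>v\<close>, has length at most
  \<open>\<epsilon>\<close>. The bound is uniform in \<open>x\<close>.\<close>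

lemma level_height_bounds:
  assumes v: "v \<in> timelike_cone" "v \<bullet>\<^sub>M v = -1" and \<epsilon>: "0 < \<epsilon>"
  shows "graph_height (frontier D) v x \<le> graph_height (level_surface D \<epsilon>) v x"
    and "graph_height (level_surface D \<epsilon>) v x \<le> graph_height (frontier D) v x + \<epsilon>"
proof -
  define h where "h = graph_height (frontier D) v x"
  define s where "s = graph_height (level_surface D \<epsilon>) v x"
  have s: "x + s *\<^sub>R v \<in> D" "cosmological_time D (x + s *\<^sub>R v) = \<epsilon>"
    using level_point[OF v(1) \<epsilon>, of x] by (auto simp: graph_point_def s_def level_surface_def)
  then have "h < s"
    using domain_above_frontier[OF v(1)] by (simp add: h_def)
  have "x + h *\<^sub>R v \<in> closure D"
    using frontier_point[OF v(1)] by (simp add: graph_point_def h_def in_frontier_iff)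
  moreover have eq: "x + s *\<^sub>R v - (x + h *\<^sub>R v) = (s - h) *\<^sub>R v"
    by (simp add: algebra_simps)
  moreover have "(s - h) *\<^sub>R v \<in> causal_cone"
    using v timelike_subset_causal \<open>h < s\<close> by (auto intro: causal_cone_scaleR)
  ultimately have "mink_norm ((s - h) *\<^sub>R v) \<le> \<epsilon>"
    using time_lower_bound[OF s(1), of "x + h *\<^sub>R v"] s(2) by simp
  moreover have "mink_norm v = 1"
    using v by (simp add: mink_norm_def)
  ultimately have "s \<le> h + \<epsilon>"
    using \<open>h < s\<close> by (simp add: mink_norm_scaleR)
  with \<open>h < s\<close> show "graph_height (frontier D) v x \<le> graph_height (level_surface D \<epsilon>) v x"
    "graph_height (level_surface D \<epsilon>) v x \<le> graph_height (frontier D) v x + \<epsilon>"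
    by (simp_all add: h_def s_def)
qed

text \<open>\<open>y - x + norm (y - x) *\<^sub>R v\<close> is causal, since the form is at most the
  squared Euclidean norm and \<open>v\<close> is a unit vector orthogonal to \<open>y - x\<close>;
  causal translations preserve the closure of \<open>D\<close>.\<close>

lemma frontier_height_lipschitz:
  assumes v: "v \<in> timelike_cone" "v \<bullet>\<^sub>M v = -1" and "(y - x) \<bullet>\<^sub>M v = 0"
  shows "graph_height (frontier D) v y \<le> graph_height (frontier D) v x + norm (y - x)"
proof -
  define w where "w = y - x + norm (y - x) *\<^sub>R v"
  have w: "w \<in> causal_cone"
  proof (cases "y = x")
    case False
    have "w \<bullet>\<^sub>M w = (y - x) \<bullet>\<^sub>M (y - x) - (norm (y - x))\<^sup>2"
      using v(2) assms(3)
      by (simp add: w_def minkowski.add_left minkowski.add_right minkowski.scaleR_left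
          minkowski.scaleR_right mink_commute[of v "y - x"] power2_eq_square)
    then have "w \<bullet>\<^sub>M w \<le> 0"
      using mink_le_norm_sq[of "y - x"] by simp
    moreover have "w \<bullet>\<^sub>M v < 0"
      using v(2) assms(3) False by (simp add: w_def minkowski.add_left minkowski.scaleR_left)
    ultimately show ?thesis
      using v(1) timelike_cone_if_mink_neg by blast
  qed (simp add: w_def)
  have "x + graph_height (frontier D) v x *\<^sub>R v + w \<in> closure D"
    using frontier_point[OF v(1), of x] w
    by (intro closure_causal_future[of "x + graph_height (frontier D) v x *\<^sub>R v"])
      (simp_all add: graph_point_def in_frontier_iff)
  then have "y + (graph_height (frontier D) v x + norm (y - x)) *\<^sub>R v \<in> closure D"
    by (simp add: w_def algebra_simps)
  then show ?thesis
    by (rule frontier_height_le[OF v(1)])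
qed

lemma frontier_point_continuous_on:
  assumes v: "v \<in> timelike_cone" "v \<bullet>\<^sub>M v = -1"
  shows "continuous_on (orthogonal_plane v) (graph_point (frontier D) v)"
proof -
  have "\<bar>graph_height (frontier D) v y - graph_height (frontier D) v x\<bar> \<le> norm (y - x)"
    if "x \<in> orthogonal_plane v" "y \<in> orthogonal_plane v" for x y
    using that frontier_height_lipschitz[OF v, of y x] frontier_height_lipschitz[OF v, of x y]
    by (auto simp: orthogonal_plane_def mink_simps norm_minus_commute abs_le_iff)
  then have "1-lipschitz_on (orthogonal_plane v) (graph_height (frontier D) v)"
    by (auto intro!: lipschitz_onI simp: dist_norm)
  then have "continuous_on (orthogonal_plane v) (graph_height (frontier D) v)"
    by (rule lipschitz_on_continuous_on)
  then show ?thesis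
    unfolding graph_point_def[abs_def] by (intro continuous_intros)
qed

subsection \<open>Normals of the level surfaces\<close>

text \<open>Near \<open>p\<close> the level surface lies between its support plane and the hyperboloid of points at
  Lorentzian distance \<open>\<epsilon>\<close> from the foot of \<open>p\<close>, which are tangent to each other at \<open>p\<close>.\<close>

lemma level_height_quadratic:
  assumes \<epsilon>: "0 < \<epsilon>" and p: "p \<in> level_surface D \<epsilon>" and w: "w \<bullet>\<^sub>M (p - retraction D p) = 0"
    and s: "p + w + s *\<^sub>R (p - retraction D p) \<in> level_surface D \<epsilon>"
  shows "0 \<le> s" "s \<le> w \<bullet>\<^sub>M w / (2 * \<epsilon>\<^sup>2)"
proof -
  define r where "r = retraction D p"
  define u where "u = p - r"
  define q where "q = p + w + s *\<^sub>R u"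
  have pD: "p \<in> D" "cosmological_time D p = \<epsilon>" and qD: "q \<in> D" "cosmological_time D q = \<epsilon>"
    using p s by (auto simp: level_surface_def q_def u_def r_def)
  have foot: "is_foot p r"
    using pD is_foot_retraction by (simp add: r_def)
  note f = is_footD[OF foot]
  have uu: "u \<bullet>\<^sub>M u = - \<epsilon>\<^sup>2"
    using mink_norm_sq[OF f(3)] time_foot[OF foot] pD by (simp add: u_def)
  have wu: "w \<bullet>\<^sub>M u = 0"
    using w by (simp add: u_def r_def)
  have "(q - p) \<bullet>\<^sub>M u \<le> 0"
    using superlevel_support[OF pD(1) qD(1)] pD qD by (simp add: u_def r_def)
  moreover have "(q - p) \<bullet>\<^sub>M u = - (s * \<epsilon>\<^sup>2)"
    using uu wu by (simp add: q_def minkowski.add_left minkowski.scaleR_left)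
  ultimately show "0 \<le> s"
    using \<epsilon> by (simp add: zero_le_mult_iff)
  have qr: "q - r = w + (1 + s) *\<^sub>R u"
    by (simp add: q_def u_def algebra_simps)
  have qr2: "(q - r) \<bullet>\<^sub>M (q - r) = w \<bullet>\<^sub>M w - (1 + s)\<^sup>2 * \<epsilon>\<^sup>2"
    unfolding qr by (simp add: minkowski.add_left minkowski.add_right minkowski.scaleR_left
        minkowski.scaleR_right uu wu mink_commute[of u w] power2_eq_square)
  show "s \<le> w \<bullet>\<^sub>M w / (2 * \<epsilon>\<^sup>2)"
  proof (rule ccontr)
    \<comment> \<open>Beyond this bound \<open>q\<close> lies strictly above the hyperboloid of
      radius \<open>\<epsilon>\<close> about \<open>r\<close>, so \<open>r\<close> as a competitor
      makes the time at \<open>q\<close> exceed \<open>\<epsilon>\<close>. The 2 comes from dropping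
      \<open>s\<^sup>2\<close> in \<open>(1 + s)\<^sup>2\<close>.\<close>
    assume "\<not> s \<le> w \<bullet>\<^sub>M w / (2 * \<epsilon>\<^sup>2)"
    then have "w \<bullet>\<^sub>M w < s * (2 * \<epsilon>\<^sup>2)"
      using \<epsilon> by (simp add: pos_divide_less_eq not_le)
    also have "\<dots> \<le> s * (2 * \<epsilon>\<^sup>2) + s\<^sup>2 * \<epsilon>\<^sup>2"
      by simp
    also have "\<dots> = (1 + s)\<^sup>2 * \<epsilon>\<^sup>2 - \<epsilon>\<^sup>2"
      by (simp add: power2_eq_square algebra_simps)
    finally have less: "(q - r) \<bullet>\<^sub>M (q - r) < - \<epsilon>\<^sup>2"
      by (simp add: qr2)
    have "(q - r) \<bullet>\<^sub>M u < 0"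
    proof -
      have "(q - r) \<bullet>\<^sub>M u = - ((1 + s) * \<epsilon>\<^sup>2)"
        unfolding qr by (simp add: minkowski.add_left minkowski.scaleR_left uu wu)
      moreover have "0 < (1 + s) * \<epsilon>\<^sup>2"
        using \<open>0 \<le> s\<close> \<epsilon> by simp
      ultimately show ?thesis
        by linarith
    qed
    moreover have "(q - r) \<bullet>\<^sub>M (q - r) \<le> 0"
      using less zero_le_power2[of \<epsilon>] by linarith
    ultimately have "q - r \<in> causal_cone"
      using f(2) by (intro timelike_cone_if_mink_neg[of _ u]) (auto simp: u_def)
    then have "mink_norm (q - r) \<le> \<epsilon>"
      using time_lower_bound[OF qD(1) f(1)] qD by simp
    then have "(mink_norm (q - r))\<^sup>2 \<le> \<epsilon>\<^sup>2"
      using mink_norm_nonneg[OF \<open>q - r \<in> causal_cone\<close>] by (rule power_mono)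
    with less mink_norm_sq[OF \<open>q - r \<in> causal_cone\<close>] show False
      by simp
  qed
qed

text \<open>Along a curve in the surface the product with \<open>p - retraction D p\<close> is
  locally maximal at \<open>p\<close>, by \<open>superlevel_support\<close>. For the converse the
  line \<open>p + t *\<^sub>R w\<close> is lifted to the surface, and the lift has height of order
  \<open>t\<^sup>2\<close>.\<close>

lemma tangent_vector_level_surface_iff:
  assumes \<epsilon>: "0 < \<epsilon>" and p: "p \<in> level_surface D \<epsilon>"
  shows "tangent_vector (level_surface D \<epsilon>) p w \<longleftrightarrow> w \<bullet>\<^sub>M (p - retraction D p) = 0"
proof
  define u where "u = p - retraction D p"
  have pD: "p \<in> D" "cosmological_time D p = \<epsilon>"
    using p by (auto simp: level_surface_def)
  assume "tangent_vector (level_surface D \<epsilon>) p w"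
  then obtain \<gamma> where \<gamma>: "\<gamma> 0 = p" "\<forall>\<^sub>F t in nhds (0::real). \<gamma> t \<in> level_surface D \<epsilon>"
    "(\<gamma> has_vector_derivative w) (at 0)"
    unfolding tangent_vector_def by blast
  have "((\<lambda>t. \<gamma> t \<bullet>\<^sub>M u) has_vector_derivative w \<bullet>\<^sub>M u) (at 0)"
    using \<gamma>(3) by (rule bounded_linear.has_vector_derivative[OF minkowski.bounded_linear_left])
  then have deriv: "((\<lambda>t. \<gamma> t \<bullet>\<^sub>M u) has_real_derivative w \<bullet>\<^sub>M u) (at 0)"
    by (simp add: has_real_derivative_iff_has_vector_derivative)
  obtain d where d: "0 < d" "\<And>t. dist t 0 < d \<Longrightarrow> \<gamma> t \<in> level_surface D \<epsilon>"
    using \<gamma>(2) unfolding eventually_nhds_metric by blast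
  have "\<gamma> t \<bullet>\<^sub>M u \<le> \<gamma> 0 \<bullet>\<^sub>M u" if "\<bar>0 - t\<bar> < d" for t
  proof -
    have "\<gamma> t \<in> level_surface D \<epsilon>"
      using that by (intro d) simp
    then have "(\<gamma> t - p) \<bullet>\<^sub>M u \<le> 0"
      unfolding u_def by (intro superlevel_support pD) (auto simp: level_surface_def pD)
    then show ?thesis
      by (simp add: \<gamma>(1) minkowski.diff_left)
  qed
  with DERIV_local_max[OF deriv d(1)] show "w \<bullet>\<^sub>M (p - retraction D p) = 0"
    unfolding u_def by blast
next
  define u where "u = p - retraction D p"
  have pD: "p \<in> D" "cosmological_time D p = \<epsilon>"
    using p by (auto simp: level_surface_def)
  have u: "u \<in> timelike_cone"
    unfolding u_def using pD is_foot_retraction is_footD by blast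
  assume w: "w \<bullet>\<^sub>M (p - retraction D p) = 0"
  \<comment> \<open>The surface is taken as a graph in the direction of its own normal at
    \<open>p\<close>, which is the form that \<open>level_height_quadratic\<close>
    estimates.\<close>
  define s where "s t = graph_height (level_surface D \<epsilon>) u (p + t *\<^sub>R w)" for t
  define \<gamma> where "\<gamma> t = p + t *\<^sub>R w + s t *\<^sub>R u" for t
  have \<gamma>: "\<gamma> t \<in> level_surface D \<epsilon>" for t
    using level_point[OF u \<epsilon>, of "p + t *\<^sub>R w"] by (simp add: \<gamma>_def s_def graph_point_def)
  have "s 0 = 0"
    unfolding s_def using p by (intro level_height_eqI[OF u]) simp
  define C where "C = w \<bullet>\<^sub>M w / (2 * \<epsilon>\<^sup>2)"
  have bound: "\<bar>s t\<bar> \<le> C * t\<^sup>2" for t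
    using level_height_quadratic[OF \<epsilon> p, of "t *\<^sub>R w" "s t"] w \<gamma>[of t]
    by (simp add: \<gamma>_def u_def C_def mink_simps power2_eq_square mult_ac)
  have "(s has_real_derivative 0) (at 0)"
    unfolding has_field_derivative_iff
  proof (rule Lim_null_comparison)
    show "\<forall>\<^sub>F t in at 0. norm ((s t - s 0) / (t - 0)) \<le> C * \<bar>t\<bar>"
    proof (rule eventually_at_filter[THEN iffD2], intro always_eventually allI impI)
      fix t :: real
      assume "t \<noteq> 0"
      then show "norm ((s t - s 0) / (t - 0)) \<le> C * \<bar>t\<bar>"
        using bound[of t] by (simp add: \<open>s 0 = 0\<close> power2_eq_square pos_divide_le_eq mult.assoc)
    qed
    show "((\<lambda>t. C * \<bar>t\<bar>) \<longlongrightarrow> 0) (at 0)"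
      by (auto intro!: tendsto_eq_intros)
  qed
  then have "(\<gamma> has_vector_derivative w) (at 0)"
    unfolding \<gamma>_def by (auto intro!: derivative_eq_intros)
  with \<gamma> show "tangent_vector (level_surface D \<epsilon>) p w"
    unfolding tangent_vector_def
    by (intro exI[of _ \<gamma>]) (auto simp: \<gamma>_def \<open>s 0 = 0\<close>)
qed

lemma future_unit_normal_level_surface:
  assumes \<epsilon>: "0 < \<epsilon>" and p: "p \<in> level_surface D \<epsilon>"
  shows "future_unit_normal (level_surface D \<epsilon>) p = (1 / \<epsilon>) *\<^sub>R (p - retraction D p)"
proof -
  define r where "r = retraction D p"
  define \<nu> where "\<nu> = (1 / \<epsilon>) *\<^sub>R (p - r)"
  have pD: "p \<in> D" "cosmological_time D p = \<epsilon>"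
    using p by (auto simp: level_surface_def)
  have foot: "is_foot p r"
    using pD is_foot_retraction by (simp add: r_def)
  note f = is_footD[OF foot]
  have "(p - r) \<bullet>\<^sub>M (p - r) = - \<epsilon>\<^sup>2"
    using mink_norm_sq[OF f(3)] time_foot[OF foot] pD by simp
  then have \<nu>\<nu>: "\<nu> \<bullet>\<^sub>M \<nu> = -1"
    using \<epsilon> by (simp add: \<nu>_def minkowski.scaleR_left minkowski.scaleR_right power2_eq_square)
  have \<nu>: "\<nu> \<in> timelike_cone"
    unfolding \<nu>_def using f \<epsilon> by (intro timelike_cone_scaleR) auto
  have tangent: "tangent_vector (level_surface D \<epsilon>) p w \<longleftrightarrow> \<nu> \<bullet>\<^sub>M w = 0" for w
    using \<epsilon> tangent_vector_level_surface_iff[OF assms]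
    by (simp add: \<nu>_def r_def minkowski.scaleR_left minkowski.scaleR_right mink_commute[of _ w])
  have "future_unit_normal (level_surface D \<epsilon>) p = \<nu>"
    unfolding future_unit_normal_def tangent
  proof (rule the_equality)
    show "\<nu> \<bullet>\<^sub>M \<nu> = -1 \<and> future_directed \<nu> \<and> (\<forall>w. \<nu> \<bullet>\<^sub>M w = 0 \<longrightarrow> \<nu> \<bullet>\<^sub>M w = 0)"
      using \<nu>\<nu> \<nu> by (simp add: future_directed_def timelike_cone_def)
    fix n
    assume n: "n \<bullet>\<^sub>M n = -1 \<and> future_directed n \<and> (\<forall>w. \<nu> \<bullet>\<^sub>M w = 0 \<longrightarrow> n \<bullet>\<^sub>M w = 0)"
    define c where "c = n \<bullet>\<^sub>M \<nu>"
    have "n \<in> causal_cone"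
      using n by (simp add: causal_cone_def future_directed_def)
    then have "c \<le> 0"
      unfolding c_def using \<nu> timelike_subset_causal by (intro causal_mink_nonpos) auto
    \<comment> \<open>\<open>n + c *\<^sub>R \<nu>\<close> is the component of \<open>n\<close>
      orthogonal to \<open>\<nu>\<close>, hence tangent and so orthogonal to \<open>n\<close>; this
      gives \<open>c\<^sup>2 = 1\<close>, and future-directedness selects
      \<open>c = -1\<close>.\<close>
    have "\<nu> \<bullet>\<^sub>M (n + c *\<^sub>R \<nu>) = 0"
      by (simp add: mink_simps \<nu>\<nu> c_def mink_commute)
    with n have "n \<bullet>\<^sub>M (n + c *\<^sub>R \<nu>) = 0"
      by blast
    then have "c\<^sup>2 = 1"
      using n by (simp add: minkowski.add_right minkowski.scaleR_right c_def power2_eq_square)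
    with \<open>c \<le> 0\<close> have "n \<bullet>\<^sub>M \<nu> = -1"
      by (auto simp: power2_eq_1_iff c_def)
    then have "n - \<nu> = 0"
      using \<nu>\<nu> n
      by (intro mink_orthogonal_timelike_zero[of \<nu>]) (simp_all add: mink_simps mink_commute[of \<nu> n])
    then show "n = \<nu>"
      by simp
  qed
  then show ?thesis
    by (simp add: \<nu>_def r_def)
qed

lemma iota_eps_eq:
  fixes x :: minkowski
  assumes "v \<in> timelike_cone" "0 < \<epsilon>"
  defines "p \<equiv> graph_point (level_surface D \<epsilon>) v x"
  shows "iota_eps D v \<epsilon> x = - ((p - retraction D p) \<bullet>\<^sub>M v)"
  using future_unit_normal_level_surface[OF assms(2) level_point[OF assms(1,2)]] assms(2)
  by (simp add: iota_eps_def p_def minkowski.scaleR_left)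

subsection \<open>Convergence\<close>

lemma I_fun_nonneg:
  assumes v: "v \<in> timelike_cone" and "q \<in> frontier D"
  shows "0 \<le> I_fun D v q"
proof -
  have "v \<in> causal_cone"
    using v timelike_subset_causal by blast
  from causal_mink_nonpos[OF retraction0_causal[OF assms(2)] this] show ?thesis
    by (simp add: I_fun_def)
qed

lemma I_fun_continuous_on:
  assumes v: "v \<in> timelike_cone" "v \<bullet>\<^sub>M v = -1" and T: "closed (initial_singularity D)"
  shows "continuous_on (orthogonal_plane v) (\<lambda>x. I_fun D v (graph_point (frontier D) v x))"
  unfolding I_fun_def
  using frontier_point[OF v(1)]
  by (intro continuous_intros minkowski.continuous_on frontier_point_continuous_on[OF v]
      continuous_on_compose2[OF retraction0_continuous_on[OF T]]) auto

text \<open>Base point and \<open>\<epsilon>\<close> vary together; this continuous convergence is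
  what becomes uniform on compact sets. Level points are within \<open>\<epsilon> k * norm v\<close>
  of the boundary points below them, so they tend to \<open>q\<close> and their feet to
  \<open>retraction0 D q\<close>.\<close>

lemma iota_eps_tendsto:
  assumes v: "v \<in> timelike_cone" "v \<bullet>\<^sub>M v = -1" and T: "closed (initial_singularity D)"
    and x: "(X \<longlongrightarrow> x) F" "x \<in> orthogonal_plane v" "\<And>k. X k \<in> orthogonal_plane v"
    and \<epsilon>: "(\<epsilon> \<longlongrightarrow> 0) F" "\<And>k. 0 < \<epsilon> k"
  shows "((\<lambda>k. iota_eps D v (\<epsilon> k) (X k)) \<longlongrightarrow> I_fun D v (graph_point (frontier D) v x)) F"
proof -
  define q where "q = graph_point (frontier D) v x"
  define p where "p k = graph_point (level_surface D (\<epsilon> k)) v (X k)" for k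
  have q: "((\<lambda>k. graph_point (frontier D) v (X k)) \<longlongrightarrow> q) F"
    unfolding q_def using frontier_point_continuous_on[OF v] x
    by (intro continuous_on_tendsto_compose[where f = "graph_point (frontier D) v"]) auto
  have "((\<lambda>k. p k - graph_point (frontier D) v (X k)) \<longlongrightarrow> 0) F"
  proof (rule Lim_null_comparison)
    show "\<forall>\<^sub>F k in F. norm (p k - graph_point (frontier D) v (X k)) \<le> \<epsilon> k * norm v"
    proof (intro always_eventually allI)
      fix k
      have "p k - graph_point (frontier D) v (X k) = (graph_height (level_surface D (\<epsilon> k)) v (X k)
          - graph_height (frontier D) v (X k)) *\<^sub>R v"
        by (simp add: p_def graph_point_def algebra_simps)
      moreover have "\<bar>graph_height (level_surface D (\<epsilon> k)) v (X k)
          - graph_height (frontier D) v (X k)\<bar> \<le> \<epsilon> k"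
        using level_height_bounds[OF v \<epsilon>(2)[of k], of "X k"] by simp
      ultimately show "norm (p k - graph_point (frontier D) v (X k)) \<le> \<epsilon> k * norm v"
        by (simp add: mult_right_mono)
    qed
    show "((\<lambda>k. \<epsilon> k * norm v) \<longlongrightarrow> 0) F"
      using \<epsilon>(1) by (rule tendsto_mult_left_zero)
  qed
  from tendsto_add[OF this q] have p: "(p \<longlongrightarrow> q) F"
    by simp
  have "p k \<in> D" for k
    using level_point[OF v(1) \<epsilon>(2)] by (simp add: p_def level_surface_def)
  then have "((\<lambda>k. retraction D (p k)) \<longlongrightarrow> retraction0 D q) F"
    using is_footD(3)[OF is_foot_retraction] frontier_point[OF v(1)]
    by (intro singularity_tendsto_retraction0[OF T _ p])
      (auto simp: q_def initial_singularity_def)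
  then have "((\<lambda>k. - ((p k - retraction D (p k)) \<bullet>\<^sub>M v)) \<longlongrightarrow> - ((q - retraction0 D q) \<bullet>\<^sub>M v)) F"
    by (intro tendsto_intros minkowski.tendsto p)
  then show ?thesis
    using iota_eps_eq[OF v(1) \<epsilon>(2)] by (simp add: I_fun_def q_def p_def)
qed

lemma iota_eps_uniform_limit:
  assumes v: "v \<in> timelike_cone" "v \<bullet>\<^sub>M v = -1" and T: "closed (initial_singularity D)"
  shows "uniform_limit_on_compacts (orthogonal_plane v) (iota_eps D v)
    (\<lambda>x. I_fun D v (graph_point (frontier D) v x)) (at_right 0)"
  unfolding uniform_limit_on_compacts_def
proof (intro allI impI, elim conjE)
  fix K
  assume K: "compact K" "K \<subseteq> orthogonal_plane v"
  define I where "I = (\<lambda>x. I_fun D v (graph_point (frontier D) v x))"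
  show "uniform_limit K (iota_eps D v) I (at_right 0)"
  proof (rule uniform_limitI, rule ccontr)
    fix e :: real
    assume "0 < e"
    assume not_ev: "\<not> (\<forall>\<^sub>F \<epsilon> in at_right 0. \<forall>x\<in>K. dist (iota_eps D v \<epsilon> x) (I x) < e)"
    \<comment> \<open>Failure at arbitrarily small \<open>\<epsilon>\<close> yields points
      \<open>X k\<close> of \<open>K\<close>; along a convergent subsequence both
      \<open>iota_eps\<close> and \<open>I\<close> tend to \<open>I x\<close>, so their distance
      tends to 0.\<close>
    have "\<exists>\<epsilon> x. 0 < \<epsilon> \<and> \<epsilon> < 1 / real (Suc k) \<and> x \<in> K \<and> \<not> dist (iota_eps D v \<epsilon> x) (I x) < e" for k
      using not_ev unfolding eventually_at_right_field
      by (metis of_nat_0_less_iff zero_less_Suc zero_less_divide_1_iff)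
    then obtain \<epsilon> X where \<epsilon>: "\<And>k. 0 < \<epsilon> k" "\<And>k. \<epsilon> k < 1 / real (Suc k)"
      and X: "\<And>k. X k \<in> K" "\<And>k. \<not> dist (iota_eps D v (\<epsilon> k) (X k)) (I (X k)) < e"
      by metis
    obtain x f where x: "x \<in> K" "strict_mono f" "(X \<circ> f) \<longlonglongrightarrow> x"
      using K(1) X(1) unfolding compact_def by metis
    have "\<epsilon> \<longlonglongrightarrow> 0"
    proof (rule real_tendsto_sandwich[OF _ _ tendsto_const])
      show "(\<lambda>k. 1 / real (Suc k)) \<longlonglongrightarrow> 0"
        using LIMSEQ_inverse_real_of_nat by (simp add: inverse_eq_divide)
    qed (intro always_eventually allI less_imp_le \<epsilon>)+
    then have "(\<epsilon> \<circ> f) \<longlonglongrightarrow> 0"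
      using x(2) by (rule LIMSEQ_subseq_LIMSEQ)
    then have "(\<lambda>k. iota_eps D v ((\<epsilon> \<circ> f) k) ((X \<circ> f) k)) \<longlonglongrightarrow> I x"
      unfolding I_def using x X(1) K(2) \<epsilon>(1) by (intro iota_eps_tendsto[OF v T]) (auto simp: o_def)
    moreover have "(\<lambda>k. I ((X \<circ> f) k)) \<longlonglongrightarrow> I x"
      unfolding I_def using x X(1) K(2)
      by (intro continuous_on_tendsto_compose[OF I_fun_continuous_on[OF v T]])
        (auto simp: o_def intro!: always_eventually)
    ultimately have "(\<lambda>k. dist (iota_eps D v ((\<epsilon> \<circ> f) k) ((X \<circ> f) k)) (I ((X \<circ> f) k))) \<longlonglongrightarrow> dist (I x) (I x)"
      by (rule tendsto_dist)
    then have "\<forall>\<^sub>F k in sequentially. dist (iota_eps D v ((\<epsilon> \<circ> f) k) ((X \<circ> f) k)) (I ((X \<circ> f) k)) < e"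
      using \<open>0 < e\<close> by (intro order_tendstoD) auto
    with X(2) show False
      by simp
  qed
qed

end

section \<open>Domains of dependence\<close>

lemma chronological_future_lightlike_plane:
  assumes n: "n \<in> causal_cone" "n \<noteq> 0"
  shows "chronological_future {x. x \<bullet>\<^sub>M n = c} = {x. x \<bullet>\<^sub>M n < c}"
proof (intro equalityI subsetI; unfold mem_Collect_eq)
  fix x
  assume "x \<in> chronological_future {x. x \<bullet>\<^sub>M n = c}"
  then obtain y where y: "y \<bullet>\<^sub>M n = c" "x - y \<in> timelike_cone"
    unfolding chronological_future_def timelike_future_iff by blast
  from timelike_mink_neg[OF y(2) n] y(1) show "x \<bullet>\<^sub>M n < c"
    by (simp add: minkowski.diff_left)
next
  fix x
  assume less: "x \<bullet>\<^sub>M n < c"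
  define t where "t = (c - x \<bullet>\<^sub>M n) / n $ 1"
  have "0 < n $ 1"
    using causal_cone_time_pos[OF n] .
  then have "(x - t *\<^sub>R time_axis) \<bullet>\<^sub>M n = c" "x - (x - t *\<^sub>R time_axis) \<in> timelike_cone"
    using less by (auto simp: t_def mink_simps intro!: timelike_cone_scaleR)
  then show "x \<in> chronological_future {x. x \<bullet>\<^sub>M n = c}"
    unfolding chronological_future_def timelike_future_iff by blast
qed

lemma lightlike_plane_future_normal:
  assumes "lightlike_plane P"
  obtains n c where "n \<in> causal_cone" "n \<noteq> 0" "n \<bullet>\<^sub>M n = 0" "P = {x. x \<bullet>\<^sub>M n = c}"
proof -
  obtain n c where n: "lightlike n" "P = {x. x \<bullet>\<^sub>M n = c}"
    using assms unfolding lightlike_plane_def by blast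
  show ?thesis
  proof (cases "0 \<le> n $ 1")
    case True
    with n show ?thesis
      using that[of n c] by (auto simp: lightlike_def causal_cone_def)
  next
    case False
    moreover have "P = {x. x \<bullet>\<^sub>M (- n) = - c}"
      using n by (simp add: minkowski.minus_right)
    ultimately show ?thesis
      using n(1) that[of "- n" "- c"]
      by (auto simp: lightlike_def causal_cone_def minkowski.minus_right minkowski.minus_left)
  qed
qed

lemma domain_of_dependence_future_convex_domain:
  assumes "domain_of_dependence D"
  shows "future_convex_domain D"
proof -
  from assms obtain \<F> where D: "D \<noteq> {}" "open D" "convex D"
    and \<F>: "\<And>P. P \<in> \<F> \<Longrightarrow> lightlike_plane P" "D = (\<Inter>P\<in>\<F>. chronological_future P)"
    unfolding domain_of_dependence_def by blast
  from assms obtain P Q where PQ: "lightlike_plane P" "lightlike_plane Q" "\<not> affine_parallel P Q"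
    "P \<subseteq> - D" "Q \<subseteq> - D"
    unfolding domain_of_dependence_def by blast
  have half_space: "\<exists>n c. n \<in> causal_cone \<and> n \<noteq> 0 \<and> n \<bullet>\<^sub>M n = 0 \<and>
      chronological_future P = {x. x \<bullet>\<^sub>M n < c}" if "P \<in> \<F>" for P
    using lightlike_plane_future_normal[OF \<F>(1)[OF that]] chronological_future_lightlike_plane
    by metis
  have future: "x + w \<in> D" if x: "x \<in> D" and w: "w \<in> causal_cone" for x w
    unfolding \<F>(2)
  proof
    fix P
    assume "P \<in> \<F>"
    then obtain n c where n: "n \<in> causal_cone" "chronological_future P = {x. x \<bullet>\<^sub>M n < c}"
      using half_space by blast
    moreover have "x \<in> chronological_future P"
      using x \<open>P \<in> \<F>\<close> \<F>(2) by blast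
    ultimately show "x + w \<in> chronological_future P"
      using causal_mink_nonpos[OF w n(1)] by (simp add: minkowski.add_left)
  qed
  have support: "\<exists>n. n \<in> causal_cone \<and> n \<noteq> 0 \<and> n \<bullet>\<^sub>M n = 0 \<and> (\<forall>x\<in>D. x \<bullet>\<^sub>M n < q \<bullet>\<^sub>M n)"
    if "q \<in> frontier D" for q
  proof -
    have "q \<notin> D"
      using that D(2) by (simp add: frontier_def interior_open)
    \<comment> \<open>One member of the family already excludes \<open>q\<close>, as
      \<open>D\<close> is the whole intersection; its half space contains \<open>D\<close> and
      supplies \<open>n\<close>.\<close>
    then obtain P where P: "P \<in> \<F>" "q \<notin> chronological_future P"
      using \<F>(2) by blast
    then obtain n c where n: "n \<in> causal_cone" "n \<noteq> 0" "n \<bullet>\<^sub>M n = 0"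
      "chronological_future P = {x. x \<bullet>\<^sub>M n < c}"
      using half_space by blast
    moreover have "x \<bullet>\<^sub>M n < c" if "x \<in> D" for x
      using that P(1) n(4) \<F>(2) by blast
    moreover have "c \<le> q \<bullet>\<^sub>M n"
      using P(2) n(4) by simp
    ultimately show ?thesis
      using less_le_trans by blast
  qed
  \<comment> \<open>If the product exceeded \<open>c\<close>, the vertical line upward from
    \<open>x\<close>, which stays in \<open>D\<close>, would meet the plane.\<close>
  have below: "x \<bullet>\<^sub>M n \<le> c"
    if "{x. x \<bullet>\<^sub>M n = c} \<subseteq> - D" "n \<in> causal_cone" "n \<noteq> 0" "x \<in> D" for x n c
  proof (rule ccontr)
    assume "\<not> x \<bullet>\<^sub>M n \<le> c"
    moreover define t where "t = (x \<bullet>\<^sub>M n - c) / n $ 1"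
    ultimately have "0 \<le> t" "(x + t *\<^sub>R time_axis) \<bullet>\<^sub>M n = c"
      using causal_cone_time_pos[OF that(2,3)] by (auto simp: mink_simps)
    moreover have "x + t *\<^sub>R time_axis \<in> D"
      using that(4) \<open>0 \<le> t\<close> timelike_subset_causal time_axis_timelike
      by (intro future causal_cone_scaleR) auto
    ultimately show False
      using that(1) by blast
  qed
  have bound: "\<exists>m\<in>timelike_cone. \<exists>c. \<forall>x\<in>D. x \<bullet>\<^sub>M m \<le> c"
  proof -
    obtain n c where n: "n \<in> causal_cone" "n \<noteq> 0" "n \<bullet>\<^sub>M n = 0" "P = {x. x \<bullet>\<^sub>M n = c}"
      using lightlike_plane_future_normal[OF PQ(1)] by blast
    obtain m d where m: "m \<in> causal_cone" "m \<noteq> 0" "m \<bullet>\<^sub>M m = 0" "Q = {x. x \<bullet>\<^sub>M m = d}"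
      using lightlike_plane_future_normal[OF PQ(2)] by blast
    have "n \<bullet>\<^sub>M m \<noteq> 0"
    proof
      assume "n \<bullet>\<^sub>M m = 0"
      then obtain k where k: "0 < k" "m = k *\<^sub>R n"
        using null_orthogonal_parallel[OF n(1,3,2) m(1,3,2)] by blast
      \<comment> \<open>The vertical translation carrying \<open>P\<close> onto \<open>Q\<close>,
        whose equation in terms of \<open>n\<close> is \<open>x \<bullet>\<^sub>M n = d / k\<close>;
        the planes would be parallel.\<close>
      define a where "a = ((c - d / k) / n $ 1) *\<^sub>R time_axis"
      have a: "a \<bullet>\<^sub>M n = d / k - c"
        using causal_cone_time_pos[OF n(1,2)] by (simp add: a_def mink_simps)
      have "Q = (+) a ` P"
      proof (intro equalityI subsetI)
        fix x
        assume "x \<in> Q"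
        then have "x \<bullet>\<^sub>M n = d / k"
          using k by (simp add: m(4) minkowski.scaleR_right eq_divide_eq mult.commute)
        then have "x - a \<in> P"
          using a by (simp add: n(4) minkowski.diff_left)
        moreover have "x = a + (x - a)"
          by simp
        ultimately show "x \<in> (+) a ` P"
          by (rule rev_image_eqI)
      next
        fix x
        assume "x \<in> (+) a ` P"
        then show "x \<in> Q"
          using a k by (auto simp: n(4) m(4) minkowski.add_left minkowski.scaleR_right algebra_simps)
      qed
      with PQ(3) show False
        unfolding affine_parallel_def by blast
    qed
    with causal_mink_nonpos[OF n(1) m(1)] have "n + m \<in> timelike_cone"
      using n m causal_cone_time_pos[of n] causal_cone_time_pos[of m]
      by (simp add: timelike_cone_def minkowski.add_left minkowski.add_right mink_commute[of m n])
    moreover have "x \<bullet>\<^sub>M (n + m) \<le> c + d" if "x \<in> D" for x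
      using below[of n c x] below[of m d x] PQ(4,5) n m that by (simp add: minkowski.add_right)
    ultimately show ?thesis
      by blast
  qed
  from D future support bound show ?thesis
    by unfold_locales
qed

theorem proposition3p3:
  fixes D :: "minkowski set" and v :: minkowski
  assumes "domain_of_dependence D"
    and "minkowski_inner v v = -1" and "future_directed v"
  shows "(\<forall>q\<in>frontier D. 0 \<le> I_fun D v q) \<and>
    (closedin (top_of_set (frontier D)) (initial_singularity D) \<longrightarrow>
      initial_singularity D = extended_singularity D \<and>
      uniform_limit_on_compacts (orthogonal_plane v) (iota_eps D v)
        (\<lambda>x. I_fun D v (graph_point (frontier D) v x)) (at_right 0) \<and>
      (\<forall>x\<in>orthogonal_plane v. iota D v x = I_fun D v (graph_point (frontier D) v x)) \<and>
      continuous_on (orthogonal_plane v) (iota D v))"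
proof -
  interpret future_convex_domain D
    using assms(1) by (rule domain_of_dependence_future_convex_domain)
  have v: "v \<in> timelike_cone"
    using assms(2,3) by (simp add: timelike_cone_def future_directed_def)
  show ?thesis
  proof (intro conjI ballI impI)
    show "0 \<le> I_fun D v q" if "q \<in> frontier D" for q
      using v that by (rule I_fun_nonneg)
  next
    assume "closedin (top_of_set (frontier D)) (initial_singularity D)"
    then have T: "closed (initial_singularity D)"
      using closedin_closed_trans frontier_closed by blast
    show "initial_singularity D = extended_singularity D"
      using T by (rule singularity_eq_extended)
    show lim: "uniform_limit_on_compacts (orthogonal_plane v) (iota_eps D v)
        (\<lambda>x. I_fun D v (graph_point (frontier D) v x)) (at_right 0)"
      using v assms(2) T by (rule iota_eps_uniform_limit)
    show iota: "iota D v x = I_fun D v (graph_point (frontier D) v x)"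
      if "x \<in> orthogonal_plane v" for x
    proof -
      have "((\<lambda>\<epsilon>. iota_eps D v \<epsilon> x) \<longlongrightarrow> I_fun D v (graph_point (frontier D) v x)) (at_right 0)"
        using lim[unfolded uniform_limit_on_compacts_def, rule_format, of "{x}"] that by simp
      then show ?thesis
        unfolding iota_def by (intro tendsto_Lim) auto
    qed
    have "continuous_on (orthogonal_plane v) (\<lambda>x. I_fun D v (graph_point (frontier D) v x))"
      using v assms(2) T by (rule I_fun_continuous_on)
    then show "continuous_on (orthogonal_plane v) (iota D v)"
      by (rule continuous_on_cong[THEN iffD1, OF refl, rotated]) (simp add: iota)
  qed
qed

end
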